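(* Let $s,d\in\mathbb{N}$ with $s>d/2$ and let $B\in\mathbb{R}^{d\times d}$ be a Frolov matrix. There is a constant $c>0$ (which may depend on $s$, $d$ and $B$) such that for any shift parameter $v\in\mathbb{R}^d$, any $n\in\mathbb{N}$ and any $f\in \mathring{H}^{s}([0,1]^d)$ \[ \sup_{u\in [1,2^{1/d}]^d} \left|Q_{n^{1/d}\hat{u}B}^v(f)-I_d(f)\right| \leq c\, n^{-s/d}\, \Vert f\Vert_{H^{s}([0,1]^d)}. \]
   Context: Notation: $\mathbb{N}=\{1,2,\dots\}$ and $I_d(f)=\int_{\mathbb{R}^d} f(x)\,dx$. For an invertible matrix $S\in\mathbb{R}^{d\times d}$ and $v\in\mathbb{R}^d$, the quadrature rule $Q_S^v$ is \[Q_S^v(f)=\frac{1}{|\det S|}\sum_{m\in\mathbb{Z}^d} f\left(S^{-\top}(m+v)\right),\] where $S^{-\top}$ is the transpose of the inverse of $S$. For $u\in\mathbb{R}^d$, $\hat{u}=\mathrm{diag}(u_1,\dots,u_d)$. A matrix $B\in\mathbb{R}^{d\times d}$ is a Frolov matrix if: (a) $B$ is invertible; (b) $\left|\prod_{j=1}^d (Bm)_j\right|\geq 1$ for every $m\in\mathbb{Z}^d\setminus\{0\}$; (c) for all $x,y\in\mathbb{R}^d$ the box $[x,y]=\{z\in\mathbb{R}^d : z_j \text{ lies between } x_j \text{ and } y_j \text{ (inclusive) for } j=1,\dots,d\}$ with volume $V=\prod_{j=1}^d|x_j-y_j|$ contains at most $V+1$ lattice points $Bm$, $m\in\mathbb{Z}^d$.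 $H^{s}(\mathbb{R}^d)$ is the space of real-valued $f\in L^2(\mathbb{R}^d)$ whose weak derivatives $D^\alpha f$ exist and lie in $L^2(\mathbb{R}^d)$ for all $\alpha\in\mathbb{N}_0^d$ with $|\alpha|=\sum_j\alpha_j\leq s$; since $s>d/2$, its elements are identified with their continuous representatives. $\mathring{H}^{s}([0,1]^d)$ is the subspace of those $f$ with support in $[0,1]^d$. The norm is $\Vert f\Vert_{H^{s}([0,1]^d)}=\left(\sum_{|\alpha|\leq s}\Vert D^\alpha f\Vert_{L^2([0,1]^d)}^2\right)^{1/2}$. *)

theory Defs
  imports "HOL-Analysis.Analysis"
begin

subsection \<open>Quadrature rules and Frolov matrices\<close>

definition int_lattice :: "(real^'d) set" where
  "int_lattice = {m. \<forall>j. m $ j \<in> \<int>}"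

definition diag :: "real^'d \<Rightarrow> real^'d^'d" where
  "diag u = (\<chi> i j. if i = j then u $ i else 0)"

text \<open>The unordered sum \<open>infsum\<close> is only a finite sum when \<open>f\<close> has compact support and
  \<open>S\<close> is invertible.\<close>

definition quadrature :: "real^'d^'d \<Rightarrow> real^'d \<Rightarrow> (real^'d \<Rightarrow> real) \<Rightarrow> real" where
  "quadrature S v f =
     1 / \<bar>det S\<bar> * (\<Sum>\<^sub>\<infinity>m\<in>int_lattice. f (transpose (matrix_inv S) *v (m + v)))"

text \<open>The corners \<open>x\<close>, \<open>y\<close> of the box need not be ordered, so this is not \<open>cbox x y\<close>.\<close>

definition between_box :: "real^'d \<Rightarrow> real^'d \<Rightarrow> (real^'d) set" where
  "between_box x y = {z. \<forall>j. min (x $ j) (y $ j) \<le> z $ j \<and> z $ j \<le> max (x $ j) (y $ j)}"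

definition frolov_matrix :: "real^'d^'d \<Rightarrow> bool" where
  "frolov_matrix B \<longleftrightarrow>
     invertible B \<and>
     (\<forall>m\<in>int_lattice - {0}. \<bar>\<Prod>j\<in>UNIV. (B *v m) $ j\<bar> \<ge> 1) \<and>
     (\<forall>x y. finite (between_box x y \<inter> (\<lambda>m. B *v m) ` int_lattice) \<and>
            real (card (between_box x y \<inter> (\<lambda>m. B *v m) ` int_lattice))
              \<le> (\<Prod>j\<in>UNIV. \<bar>x $ j - y $ j\<bar>) + 1)"

subsection \<open>Weak derivatives and Sobolev spaces\<close>

definition partial :: "'d \<Rightarrow> (real^'d \<Rightarrow> real) \<Rightarrow> real^'d \<Rightarrow> real" where
  "partial j \<phi> x = frechet_derivative \<phi> (at x) (axis j 1)"

definition smooth :: "(real^'d \<Rightarrow> real) \<Rightarrow> bool" where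
  "smooth \<phi> \<longleftrightarrow> (\<forall>js. foldr partial js \<phi> differentiable_on UNIV)"

definition test_function :: "(real^'d \<Rightarrow> real) \<Rightarrow> bool" where
  "test_function \<phi> \<longleftrightarrow> smooth \<phi> \<and> compact (closure {x. \<phi> x \<noteq> 0})"

definition multi_order :: "nat^'d \<Rightarrow> nat" where
  "multi_order \<alpha> = (\<Sum>j\<in>UNIV. \<alpha> $ j)"

text \<open>The index type carries no order, so the order of differentiation is an arbitrary choice;
  on smooth functions it is immaterial by Schwarz's theorem.\<close>

definition multi_partial :: "nat^'d \<Rightarrow> (real^'d \<Rightarrow> real) \<Rightarrow> real^'d \<Rightarrow> real" where
  "multi_partial \<alpha> \<phi> = foldr partial (SOME js. \<forall>j. count_list js j = \<alpha> $ j) \<phi>"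

definition locally_integrable :: "(real^'d \<Rightarrow> real) \<Rightarrow> bool" where
  "locally_integrable g \<longleftrightarrow> (\<forall>K. compact K \<longrightarrow> set_integrable lborel K g)"

definition is_weak_deriv :: "nat^'d \<Rightarrow> (real^'d \<Rightarrow> real) \<Rightarrow> (real^'d \<Rightarrow> real) \<Rightarrow> bool" where
  "is_weak_deriv \<alpha> f g \<longleftrightarrow>
     locally_integrable f \<and> locally_integrable g \<and>
     (\<forall>\<phi>. test_function \<phi> \<longrightarrow>
        (LINT x|lborel. f x * multi_partial \<alpha> \<phi> x)
          = (-1) ^ multi_order \<alpha> * (LINT x|lborel. g x * \<phi> x))"

text \<open>Weak derivatives are unique up to null sets, so the choice of representative affects
  neither square integrability nor the norm below.\<close>

definition weak_deriv :: "nat^'d \<Rightarrow> (real^'d \<Rightarrow> real) \<Rightarrow> real^'d \<Rightarrow> real" where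
  "weak_deriv \<alpha> f = (SOME g. is_weak_deriv \<alpha> f g)"

definition square_integrable :: "(real^'d \<Rightarrow> real) \<Rightarrow> bool" where
  "square_integrable g \<longleftrightarrow> g \<in> borel_measurable lborel \<and> integrable lborel (\<lambda>x. (g x)\<^sup>2)"

definition L2_norm_on :: "(real^'d) set \<Rightarrow> (real^'d \<Rightarrow> real) \<Rightarrow> real" where
  "L2_norm_on A g = sqrt (LINT x:A|lborel. (g x)\<^sup>2)"

definition sobolev :: "nat \<Rightarrow> (real^'d \<Rightarrow> real) set" where
  "sobolev s = {f. square_integrable f \<and>
     (\<forall>\<alpha>. multi_order \<alpha> \<le> s \<longrightarrow>
        (\<exists>g. is_weak_deriv \<alpha> f g) \<and> square_integrable (weak_deriv \<alpha> f))}"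

text \<open>Elements are continuous representatives, so pointwise evaluation is meaningful and the
  support is the topological one. This matches the usual space only for \<open>s > d / 2\<close>.\<close>

definition sobolev_cube :: "nat \<Rightarrow> (real^'d \<Rightarrow> real) set" where
  "sobolev_cube s =
     {f \<in> sobolev s. continuous_on UNIV f \<and> closure {x. f x \<noteq> 0} \<subseteq> cbox 0 1}"

definition sobolev_norm :: "nat \<Rightarrow> (real^'d \<Rightarrow> real) \<Rightarrow> real" where
  "sobolev_norm s f =
     sqrt (\<Sum>\<alpha> | multi_order \<alpha> \<le> s. (L2_norm_on (cbox 0 1) (weak_deriv \<alpha> f))\<^sup>2)"

lemma finite_multi_order_le: "finite {\<alpha> :: nat^'d. multi_order \<alpha> \<le> s}"
proof (rule finite_subset)
  have "\<alpha> $ j \<le> multi_order \<alpha>" for \<alpha> :: "nat^'d" and j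
    unfolding multi_order_def by (rule member_le_sum) auto
  then show "{\<alpha> :: nat^'d. multi_order \<alpha> \<le> s} \<subseteq> vec_lambda ` (UNIV \<rightarrow>\<^sub>E {..s})"
    by (auto intro!: image_eqI[where x = "vec_nth _"] simp: vec_lambda_eta intro: order_trans)
  show "finite (vec_lambda ` (UNIV \<rightarrow>\<^sub>E {..s}) :: (nat^'d) set)"
    by (intro finite_imageI finite_PiE) auto
qed

lemma multi_index_list_exists: "\<exists>js. \<forall>j. count_list js j = (\<alpha> :: nat^'d) $ j"
proof -
  obtain js where "mset js = (\<Sum>j\<in>UNIV. replicate_mset (\<alpha> $ j) j)"
    using ex_mset by blast
  then have "count_list js j = \<alpha> $ j" for j
    by (simp add: count_mset[symmetric] count_sum)
  then show ?thesis by blast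
qed

end

theory Submission
  imports Defs "HOL-Computational_Algebra.Polynomial"
begin

text \<open>
  Write \<open>S = n\<^bsup>1/d\<^esup> u B\<close>. By Poisson summation the error is at most the sum of
  \<open>\<bar>f^(S m)\<bar>\<close> over the nonzero integer points \<open>m\<close>. Cauchy-Schwarz with the weights
  \<open>(n\<^bsup>1/d\<^esup> \<bar>B m\<bar>)\<^sup>s\<close> splits this into two factors. The sum of \<open>\<bar>B m\<bar>\<^bsup>-2s\<^esup>\<close> converges by
  dyadic counting with the Frolov properties, since \<open>2s > d\<close>, which leaves the factor \<open>n\<^bsup>-s/d\<^esup>\<close>.
  The other factor involves \<open>\<bar>(S m)\<^sub>j\<bar>\<^sup>s \<bar>f^(S m)\<bar>\<close>, that is, the Fourier transforms of the pure
  derivatives of order \<open>s\<close> on the lattice of the points \<open>S m\<close>. Their square sums are bounded by \<open>L\<^sup>2\<close>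
  norms uniformly in \<open>n\<close>, because the unit cube meets \<open>O(n)\<close> cells of the dual lattice, each of
  volume \<open>1 / \<bar>det S\<bar>\<close>.
\<close>

text \<open>The periodization of f is continuous, but its Fourier series is not known in advance to
  converge to it at a given point. Bounds on Fourier coefficients are therefore stated for arbitrary
  finite sets \<open>A\<close> of frequencies, and Poisson summation is replaced by averages against
  trigonometric polynomials, each of which tests only finitely many coefficients.

  Uniformity in the parameters has two sources. The shift v multiplies each coefficient by a number
  of modulus 1 and disappears under absolute values. The vector u enters only through the diagonal w
  = r u with r = n^(1/d), and only by way of r \<le> w_i \<le> 2 r.

  Pure derivatives suffice because the maximum norm of B m is attained at some coordinate. Weak
  derivatives are accessible only through compactly supported test functions, so plane waves have to
  be cut off; since f vanishes outside the open cube, the cutoffs do not affect the side of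
  f.\<close>

subsection \<open>Linear substitutions\<close>

lemma det_shear:
  fixes m n :: "'n::finite"
  assumes "m \<noteq> n"
  shows "det (matrix (\<lambda>v::real^'n. \<chi> i. if i = m then v $ m + v $ n else v $ i)) = 1"
proof -
  have "matrix (\<lambda>v::real^'n. \<chi> i. if i = m then v $ m + v $ n else v $ i) =
      (\<chi> k. if k = m then row m (mat 1) + 1 *s row n (mat 1) else row k (mat 1))"
    by (auto simp: matrix_def row_def mat_def axis_def vec_eq_iff)
  then show ?thesis
    using det_row_operation[OF assms, of "mat 1 :: real^'n^'n" 1] by simp
qed

lemma measure_shear_cbox:
  fixes a b :: "real^'n"
  assumes "m \<noteq> n"
  shows "measure lebesgue ((\<lambda>v. \<chi> i. if i = m then v $ m + v $ n else v $ i) ` cbox a b)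
    = measure lebesgue (cbox a b)"
proof (cases "cbox a b = {}")
  case False
  let ?h = "\<lambda>v::real^'n. \<chi> i. if i = m then v $ m + v $ n else v $ i"
  have lin: "linear ?h"
    by (rule linearI) (auto simp: algebra_simps vec_eq_iff)
  \<comment> \<open>\<open>measure_shear_interval\<close> wants a nonnegative lower corner in
    coordinate \<open>n\<close>; this translation moves that corner to 0.\<close>
  define t :: "real^'n" where "t = axis n (- (a $ n))"
  have "measure lebesgue (?h ` cbox a b) = measure lebesgue ((+) (?h t) ` ?h ` cbox a b)"
    by (simp add: measure_translation)
  also have "(+) (?h t) ` ?h ` cbox a b = ?h ` (+) t ` cbox a b"
    using linear_add[OF lin] by (simp add: image_image)
  also have "\<dots> = ?h ` cbox (t + a) (t + b)"
    by (simp add: cbox_translation)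
  also have "measure lebesgue \<dots> = measure lebesgue (cbox (t + a) (t + b))"
    using False assms by (intro measure_shear_interval) (auto simp: t_def axis_def cbox_translation)
  also have "\<dots> = measure lebesgue ((+) t ` cbox a b)"
    by (simp add: cbox_translation)
  also have "\<dots> = measure lebesgue (cbox a b)"
    by (rule measure_translation)
  finally show ?thesis .
qed auto

lemma measure_permute_cbox:
  fixes a b :: "real^'n"
  shows "measure lebesgue ((\<lambda>v. \<chi> i. v $ Transposition.transpose m n i) ` cbox a b)
    = measure lebesgue (cbox a b)"
proof (cases "cbox a b = {}")
  case False
  let ?h = "\<lambda>v::real^'n. \<chi> i. v $ Transposition.transpose m n i"
  have hh: "?h (?h x) = x" for x
    by (simp add: vec_eq_iff)
  have sub: "?h ` cbox c d \<subseteq> cbox (?h c) (?h d)" for c d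
    by (auto simp: mem_box_cart)
  \<comment> \<open>The map is an involution, so applying the inclusion \<open>sub\<close> to the
    image corners yields the reverse inclusion.\<close>
  have "cbox (?h a) (?h b) \<subseteq> ?h ` cbox a b"
    using image_mono[OF sub[of "?h a" "?h b"], of ?h] by (simp only: image_image hh image_ident)
  with sub[of a b] have eq: "?h ` cbox a b = cbox (?h a) (?h b)"
    by blast
  then have "cbox (?h a) (?h b) \<noteq> {}"
    using False by blast
  then have "measure lebesgue (cbox (?h a) (?h b))
      = (\<Prod>i\<in>UNIV. b $ Transposition.transpose m n i - a $ Transposition.transpose m n i)"
    by (simp add: content_cbox_cart)
  also have "\<dots> = (\<Prod>i\<in>UNIV. b $ i - a $ i)"
    by (rule prod.reindex_bij_betw) simp
  also have "\<dots> = measure lebesgue (cbox a b)"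
    using False by (simp add: content_cbox_cart)
  finally show ?thesis
    by (simp add: eq)
qed auto

text \<open>The library's \<open>measure_linear_image\<close> assumes a well-ordered index type, but uses the order
  only to compute the determinant of a shear.\<close>

lemma measure_linear_image_finite:
  fixes f :: "real^'n \<Rightarrow> real^'n"
  assumes "linear f" "S \<in> lmeasurable"
  shows "f ` S \<in> lmeasurable \<and> measure lebesgue (f ` S) = \<bar>det (matrix f)\<bar> * measure lebesgue S"
proof -
  have "\<forall>S \<in> lmeasurable. f ` S \<in> lmeasurable
      \<and> measure lebesgue (f ` S) = \<bar>det (matrix f)\<bar> * measure lebesgue S"
  proof (rule induct_linear_elementary [OF \<open>linear f\<close>]; intro ballI)
    fix f g :: "real^'n \<Rightarrow> real^'n" and S :: "(real^'n) set"
    assume "linear f" "linear g" and S: "S \<in> lmeasurable"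
      and f: "\<forall>S \<in> lmeasurable. f ` S \<in> lmeasurable \<and>
        measure lebesgue (f ` S) = \<bar>det (matrix f)\<bar> * measure lebesgue S"
      and g: "\<forall>S \<in> lmeasurable. g ` S \<in> lmeasurable \<and>
        measure lebesgue (g ` S) = \<bar>det (matrix g)\<bar> * measure lebesgue S"
    have "det (matrix (f \<circ> g)) = det (matrix f) * det (matrix g)"
      using matrix_compose[OF \<open>linear g\<close> \<open>linear f\<close>] by (simp add: det_mul)
    moreover have "(f \<circ> g) ` S = f ` g ` S"
      by (simp add: image_comp)
    ultimately show "(f \<circ> g) ` S \<in> lmeasurable \<and>
        measure lebesgue ((f \<circ> g) ` S) = \<bar>det (matrix (f \<circ> g))\<bar> * measure lebesgue S"
      using f g S by (auto simp: abs_mult)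
  next
    fix f :: "real^'n \<Rightarrow> real^'n" and i and S :: "(real^'n) set"
    assume "linear f" and 0: "\<And>x. f x $ i = 0"
    have "\<not> surj f"
      using 0 by (metis surjD vec_component one_neq_zero)
    then have "\<not> inj f"
      using linear_injective_imp_surjective[OF \<open>linear f\<close>] by blast
    then have "negligible (f ` S)" "det (matrix f) = 0"
      using negligible_linear_singular_image[OF \<open>linear f\<close>] det_nz_iff_inj[OF \<open>linear f\<close>] by auto
    then show "f ` S \<in> lmeasurable \<and> measure lebesgue (f ` S) = \<bar>det (matrix f)\<bar> * measure lebesgue S"
      by (simp add: negligible_iff_measure)
  next
    fix c :: "'n \<Rightarrow> real" and S :: "(real^'n) set"
    assume S: "S \<in> lmeasurable"
    have "det (matrix (\<lambda>x::real^'n. \<chi> i. c i * x $ i)) = prod c UNIV"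
      by (subst det_diagonal) (auto simp: matrix_def axis_def)
    then show "(\<lambda>x. \<chi> i. c i * x $ i) ` S \<in> lmeasurable \<and> measure lebesgue ((\<lambda>x. \<chi> i. c i * x $ i) ` S)
        = \<bar>det (matrix (\<lambda>x::real^'n. \<chi> i. c i * x $ i))\<bar> * measure lebesgue S"
      using measurable_stretch[OF S, of c] measure_stretch[OF S, of c] by simp
  next
    fix m n :: 'n and S :: "(real^'n) set"
    assume "m \<noteq> n" and S: "S \<in> lmeasurable"
    let ?h = "\<lambda>x::real^'n. \<chi> i. x $ Transposition.transpose m n i"
    have lin: "linear ?h"
      by (rule linearI) (simp_all add: vec_eq_iff)
    \<comment> \<open>An involution has determinant of square 1, so no sign of a permutation needs
      to be computed.\<close>
    have "?h \<circ> ?h = id"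
      by (simp add: fun_eq_iff vec_eq_iff)
    then have "det (matrix ?h) * det (matrix ?h) = 1"
      using matrix_compose[OF lin lin] det_mul[of "matrix ?h" "matrix ?h"] by (metis det_I matrix_id_mat_1)
    then have "\<bar>det (matrix ?h)\<bar> = 1"
      by (auto simp: power2_eq_1_iff power2_eq_square[symmetric])
    moreover have "?h ` S \<in> lmeasurable \<and> 1 * measure lebesgue S = measure lebesgue (?h ` S)"
      by (rule measure_linear_sufficient[OF lin S]) (simp add: measure_permute_cbox)
    ultimately show "?h ` S \<in> lmeasurable \<and> measure lebesgue (?h ` S) = \<bar>det (matrix ?h)\<bar> * measure lebesgue S"
      by simp
  next
    fix m n :: 'n and S :: "(real^'n) set"
    assume mn: "m \<noteq> n" and S: "S \<in> lmeasurable"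
    let ?h = "\<lambda>x::real^'n. \<chi> i. if i = m then x $ m + x $ n else x $ i"
    have lin: "linear ?h"
      by (rule linearI) (auto simp: algebra_simps vec_eq_iff)
    have "?h ` S \<in> lmeasurable \<and> 1 * measure lebesgue S = measure lebesgue (?h ` S)"
      by (rule measure_linear_sufficient[OF lin S]) (simp add: measure_shear_cbox[OF mn])
    then show "?h ` S \<in> lmeasurable \<and> measure lebesgue (?h ` S) = \<bar>det (matrix ?h)\<bar> * measure lebesgue S"
      by (simp add: det_shear[OF mn])
  qed
  with assms show ?thesis
    by blast
qed

lemma borel_measurable_matrix_vector_mult [measurable, simp]:
  fixes A :: "real^'n^'m"
  shows "(*v) A \<in> borel_measurable borel"
  by (intro borel_measurable_continuous_onI linear_continuous_on matrix_vector_mul_bounded_linear)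

text \<open>The preimage of a box under A is its image under the inverse of A, whose volume carries
  the factor 1 / \<bar>det A\<bar>; agreement on boxes determines the measure. An identity of
  measures transfers integrability as well as integrals.\<close>

lemma lborel_linear:
  fixes A :: "real^'n^'n"
  assumes "invertible A"
  shows "lborel = density (distr lborel borel ((*v) A)) (\<lambda>_. ennreal \<bar>det A\<bar>)"
proof (rule lborel_eqI)
  fix l u :: "real^'n"
  assume lu: "\<And>b. b \<in> Basis \<Longrightarrow> l \<bullet> b \<le> u \<bullet> b"
  obtain A' where A': "A ** A' = mat 1" "A' ** A = mat 1"
    using assms by (auto simp: invertible_def)
  have meas: "(*v) A \<in> borel_measurable lborel"
    by simp
  have eq: "(*v) A -` box l u = (*v) A' ` box l u"
  proof safe
    fix x assume "A *v x \<in> box l u"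
    then show "x \<in> (*v) A' ` box l u"
      using A'(2) by (intro image_eqI[of _ _ "A *v x"]) (auto simp: matrix_vector_mul_assoc)
  qed (use A'(1) in \<open>auto simp: matrix_vector_mul_assoc\<close>)
  have lin: "linear ((*v) A')"
    by simp
  have box: "box l u \<in> lmeasurable"
    by simp
  have im: "(*v) A' ` box l u \<in> lmeasurable"
    "measure lebesgue ((*v) A' ` box l u) = \<bar>det A'\<bar> * measure lebesgue (box l u)"
    using measure_linear_image_finite[OF lin box] by auto
  have bor: "(*v) A' ` box l u \<in> sets borel"
    unfolding eq[symmetric] using measurable_sets[OF meas, of "box l u"] by simp
  have detA: "\<bar>det A\<bar> * \<bar>det A'\<bar> = 1"
    using A'(1) det_mul[of A A'] by (simp flip: abs_mult)
  have "emeasure (density (distr lborel borel ((*v) A)) (\<lambda>_. ennreal \<bar>det A\<bar>)) (box l u)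
      = ennreal \<bar>det A\<bar> * emeasure lborel ((*v) A' ` box l u)"
    using meas by (simp add: emeasure_density nn_integral_cmult_indicator emeasure_distr eq)
  also have "emeasure lborel ((*v) A' ` box l u) = emeasure lebesgue ((*v) A' ` box l u)"
    using bor by (simp add: emeasure_completion)
  also have "\<dots> = ennreal (\<bar>det A'\<bar> * measure lebesgue (box l u))"
    using im emeasure_eq_measure2[of "(*v) A' ` box l u" lebesgue] fmeasurableD2[OF im(1)]
    by (simp add: emeasure_eq_ennreal_measure)
  also have "ennreal \<bar>det A\<bar> * \<dots> = ennreal (measure lebesgue (box l u))"
    using detA by (simp add: mult.assoc[symmetric] flip: ennreal_mult')
  also have "\<dots> = ennreal (\<Prod>b\<in>Basis. (u - l) \<bullet> b)"
    using lu by (subst measure_completion) (auto simp: measure_lborel_box)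
  finally show "emeasure (density (distr lborel borel ((*v) A)) (\<lambda>_. ennreal \<bar>det A\<bar>)) (box l u)
      = ennreal (\<Prod>b\<in>Basis. (u - l) \<bullet> b)" .
qed simp

lemma lborel_integral_linear:
  fixes A :: "real^'n^'n" and f :: "real^'n \<Rightarrow> 'a::{banach, second_countable_topology}"
  assumes "invertible A" and f: "f \<in> borel_measurable borel"
  shows "\<bar>det A\<bar> *\<^sub>R (LINT x|lborel. f (A *v x)) = (LINT x|lborel. f x)"
proof -
  have meas: "(*v) A \<in> borel_measurable lborel"
    by simp
  have "(LINT x|lborel. f x) =
      (LINT x|density (distr lborel borel ((*v) A)) (\<lambda>_. ennreal \<bar>det A\<bar>). f x)"
    using lborel_linear[OF assms(1)] by simp
  also have "\<dots> = (LINT x|distr lborel borel ((*v) A). \<bar>det A\<bar> *\<^sub>R f x)"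
    using f by (intro integral_density) auto
  also have "\<dots> = \<bar>det A\<bar> *\<^sub>R (LINT x|distr lborel borel ((*v) A). f x)"
    by simp
  also have "(LINT x|distr lborel borel ((*v) A). f x) = (LINT x|lborel. f (A *v x))"
    using meas f by (intro integral_distr) auto
  finally show ?thesis by simp
qed

subsection \<open>Characters and the integer lattice\<close>

definition char :: "real^'d \<Rightarrow> real^'d \<Rightarrow> complex" where
  "char m x = cis (2 * pi * (m \<bullet> x))"

lemma norm_char [simp]: "cmod (char m x) = 1"
  by (simp add: char_def)

lemma char_0 [simp]: "char 0 x = 1"
  by (simp add: char_def)

lemma char_add_left: "char (m + k) x = char m x * char k x"
  by (simp add: char_def inner_left_distrib cis_mult algebra_simps)

lemma char_add_right: "char m (x + y) = char m x * char m y"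
  by (simp add: char_def inner_right_distrib cis_mult algebra_simps)

lemma cnj_char: "cnj (char m x) = char (- m) x"
  by (simp add: char_def cis_cnj)

lemma continuous_on_char [continuous_intros]: "continuous_on S (char m)"
  unfolding char_def cis_conv_exp by (intro continuous_intros)

lemma borel_measurable_char [measurable]: "char m \<in> borel_measurable borel"
  by (intro borel_measurable_continuous_onI continuous_intros)

lemma int_lattice_0 [simp]: "0 \<in> int_lattice"
  and int_lattice_add: "m \<in> int_lattice \<Longrightarrow> k \<in> int_lattice \<Longrightarrow> m + k \<in> int_lattice"
  and int_lattice_diff: "m \<in> int_lattice \<Longrightarrow> k \<in> int_lattice \<Longrightarrow> m - k \<in> int_lattice"
  and int_lattice_uminus: "m \<in> int_lattice \<Longrightarrow> - m \<in> int_lattice"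
  and int_lattice_axis: "axis j 1 \<in> int_lattice"
  by (auto simp: int_lattice_def axis_def)

lemma set_integral_norm_le:
  fixes f :: "'a \<Rightarrow> 'b::{banach, second_countable_topology}" and g :: "'a \<Rightarrow> real"
  assumes "set_integrable M A f" "set_integrable M A g" "\<And>x. x \<in> A \<Longrightarrow> norm (f x) \<le> g x"
  shows "norm (LINT x:A|M. f x) \<le> (LINT x:A|M. g x)"
proof -
  have "norm (LINT x:A|M. f x) \<le> (LINT x:A|M. norm (f x))"
    by (rule set_integral_norm_bound) fact
  also have "\<dots> \<le> (LINT x:A|M. g x)"
    using assms by (intro set_integral_mono set_integrable_norm)
  finally show ?thesis .
qed

lemma char_lattice:
  assumes "m \<in> int_lattice" "k \<in> int_lattice"
  shows "char m k = 1"
proof -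
  have "m \<bullet> k \<in> \<int>"
    using assms by (auto simp: inner_vec_def int_lattice_def intro!: Ints_sum Ints_mult)
  then obtain i where "m \<bullet> k = of_int i"
    by (elim Ints_cases)
  then show ?thesis
    by (simp add: char_def cis_conv_exp mult.commute exp_eq_1)
qed

subsection \<open>Tiling by the unit cell\<close>

text \<open>Half-open, so that the integer translates partition the space exactly, without overlaps
  on faces. Centred, so that 0 is an interior point, as the concentration argument at 0
  requires.\<close>

definition unit_cell :: "(real^'d) set" where
  "unit_cell = {x. \<forall>j. - 1/2 \<le> x $ j \<and> x $ j < 1/2}"

definition nearest :: "real^'d \<Rightarrow> real^'d" where
  "nearest x = (\<chi> j. of_int \<lfloor>x $ j + 1/2\<rfloor>)"

lemma minus_in_unit_cell_iff:
  assumes "m \<in> int_lattice"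
  shows "x - m \<in> unit_cell \<longleftrightarrow> m = nearest x"
proof -
  have "- 1/2 \<le> (x - m) $ j \<and> (x - m) $ j < 1/2 \<longleftrightarrow> m $ j = nearest x $ j" for j
  proof -
    obtain i where "m $ j = of_int i"
      using assms by (auto simp: int_lattice_def elim: Ints_cases)
    then show ?thesis
      by (auto simp: nearest_def) linarith+
  qed
  then show ?thesis
    by (auto simp: unit_cell_def vec_eq_iff)
qed

lemma sum_indicator_unit_cell:
  assumes "finite M" "M \<subseteq> int_lattice" "nearest x \<in> M"
  shows "(\<Sum>m\<in>M. indicator unit_cell (x - m)) = (1::real)"
proof -
  have "(\<Sum>m\<in>M. indicator unit_cell (x - m)) = (\<Sum>m\<in>M. if m = nearest x then 1 else (0::real))"
    using assms(2) by (intro sum.cong) (auto simp: indicator_def minus_in_unit_cell_iff)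
  then show ?thesis
    using assms by simp
qed

lemma borel_unit_cell [measurable]: "unit_cell \<in> sets borel"
proof -
  have "unit_cell = (\<Inter>j. {x::real^'d. - 1/2 \<le> x $ j} \<inter> {x. x $ j < 1/2})"
    by (auto simp: unit_cell_def)
  also have "\<dots> \<in> sets borel"
    by (intro sets.countable_INT'') auto
  finally show ?thesis .
qed

lemma unit_cell_subset_cbox: "unit_cell \<subseteq> cbox (\<chi> j. -1/2) (\<chi> j. 1/2)"
  by (auto simp: unit_cell_def mem_box_cart less_imp_le)

lemma emeasure_unit_cell: "emeasure lborel (unit_cell :: (real^'d) set) = 1"
proof (rule antisym)
  have "emeasure lborel (unit_cell :: (real^'d) set)
      \<le> emeasure lborel (cbox (\<chi> j. -1/2) (\<chi> j. 1/2) :: (real^'d) set)"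
    by (intro emeasure_mono unit_cell_subset_cbox) auto
  also have "\<dots> = 1"
    by (subst emeasure_lborel_cbox) (auto simp: Basis_vec_def inner_axis prod.neutral)
  finally show "emeasure lborel (unit_cell :: (real^'d) set) \<le> 1" .
  have "1 = emeasure lborel (box (\<chi> j. -1/2) (\<chi> j. 1/2) :: (real^'d) set)"
    by (subst emeasure_lborel_box) (auto simp: Basis_vec_def inner_axis prod.neutral)
  also have "\<dots> \<le> emeasure lborel (unit_cell :: (real^'d) set)"
    by (intro emeasure_mono) (auto simp: unit_cell_def mem_box_cart less_imp_le)
  finally show "1 \<le> emeasure lborel (unit_cell :: (real^'d) set)" .
qed

lemma integrable_unit_cell:
  fixes f :: "real^'d \<Rightarrow> 'b::{banach, second_countable_topology}"
  assumes "f \<in> borel_measurable borel" "\<And>x. x \<in> unit_cell \<Longrightarrow> norm (f x) \<le> K"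
  shows "set_integrable lborel unit_cell f"
  unfolding set_integrable_def
  using assms by (intro integrableI_bounded_set_indicator[where B = K]) (auto simp: emeasure_unit_cell)

lemma integral_unit_cell_const: "(LINT x:unit_cell|lborel. (c :: complex)) = c"
  by (simp add: set_lebesgue_integral_def measure_def emeasure_unit_cell)

section \<open>Integer points in a cube\<close>

definition lattice_box :: "nat \<Rightarrow> (real^'d) set" where
  "lattice_box L = {m \<in> int_lattice. \<forall>j. \<bar>m $ j\<bar> \<le> real L}"

lemma lattice_box_subset: "lattice_box L \<subseteq> int_lattice"
  by (auto simp: lattice_box_def)

lemma lattice_box_uminus: "m \<in> lattice_box L \<Longrightarrow> - m \<in> lattice_box L"
  by (auto simp: lattice_box_def int_lattice_uminus)

lemma finite_lattice_box: "finite (lattice_box L :: (real^'d) set)" (is ?fin)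
  and card_lattice_box_le: "card (lattice_box L :: (real^'d) set) \<le> (2 * L + 1) ^ CARD('d)" (is ?card)
proof -
  let ?P = "(UNIV :: 'd set) \<rightarrow>\<^sub>E {- int L..int L}"
  have fP: "finite ?P"
    by (intro finite_PiE) auto
  have sub: "lattice_box L \<subseteq> (\<lambda>g. \<chi> j. real_of_int (g j)) ` ?P"
  proof
    fix m :: "real^'d" assume m: "m \<in> lattice_box L"
    have *: "m $ j = of_int \<lfloor>m $ j\<rfloor> \<and> \<bar>\<lfloor>m $ j\<rfloor>\<bar> \<le> int L" for j
    proof -
      obtain i where i: "m $ j = of_int i"
        using m Ints_cases[of "m $ j"] by (auto simp: lattice_box_def int_lattice_def)
      moreover have "\<bar>m $ j\<bar> \<le> real L"
        using m by (auto simp: lattice_box_def)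
      ultimately show ?thesis
        by simp
    qed
    then have "m = (\<chi> j. of_int \<lfloor>m $ j\<rfloor>)"
      by (simp add: vec_eq_iff)
    moreover have "(\<lambda>j. \<lfloor>m $ j\<rfloor>) \<in> ?P"
      using * by (simp add: PiE_def Pi_def abs_le_iff) (meson minus_le_iff)
    ultimately show "m \<in> (\<lambda>g. \<chi> j. real_of_int (g j)) ` ?P"
      by (rule image_eqI)
  qed
  show ?fin
    using sub fP by (meson finite_imageI finite_subset)
  have "card (lattice_box L :: (real^'d) set) \<le> card ?P"
    using sub fP by (meson card_image_le card_mono finite_imageI order_trans)
  also have "\<dots> = (2 * L + 1) ^ CARD('d)"
    by (simp add: card_PiE nat_add_distrib nat_mult_distrib)
  finally show ?card .
qed

lemma nearest_in_lattice: "nearest x \<in> int_lattice"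
  by (auto simp: nearest_def int_lattice_def)

text \<open>Rounding moves a coordinate by at most 1/2, hence the margin of one. It reappears as 2
  (L + 1) + 1 = 2 L + 3 in the cell count of \<open>bessel_matrix_lattice\<close>.\<close>

lemma nearest_in_lattice_box:
  assumes "\<And>j. \<bar>x $ j\<bar> \<le> real L"
  shows "nearest x \<in> lattice_box (Suc L)"
proof -
  have "\<bar>nearest x $ j\<bar> \<le> real (Suc L)" for j
    using assms[of j] by (simp add: nearest_def) linarith
  then show ?thesis
    by (auto simp: lattice_box_def nearest_in_lattice)
qed

section \<open>Integrals cut along the cells\<close>

lemma lborel_integral_translate:
  fixes f :: "'a::euclidean_space \<Rightarrow> 'b::{banach, second_countable_topology}"
  assumes "f \<in> borel_measurable borel"
  shows "(LINT x|lborel. f (x + c)) = (LINT x|lborel. f x)"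
proof -
  have "(LINT x|lborel. f x) = (LINT x|distr lborel borel ((+) c). f x)"
    by (simp add: lborel_distr_plus)
  also have "\<dots> = (LINT x|lborel. f (c + x))"
    using assms by (intro integral_distr) auto
  finally show ?thesis
    by (simp add: add.commute)
qed

lemma integrable_lborel_translate:
  fixes f :: "'a::euclidean_space \<Rightarrow> 'b::{banach, second_countable_topology}"
  assumes "integrable lborel f"
  shows "integrable lborel (\<lambda>x. f (x + c))"
proof -
  have "integrable (distr lborel borel ((+) c)) f"
    by (simp add: lborel_distr_plus assms)
  then show ?thesis
    by (subst (asm) integrable_distr_eq) (use assms in \<open>auto simp: add.commute\<close>)
qed

text \<open>The finite set \<open>M\<close> indexes cells that catch the whole support, so inserting
  the partition into cells leaves only a finite sum to exchange with the integral.\<close>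

lemma integral_eq_sum_unit_cells:
  fixes h :: "real^'d \<Rightarrow> 'b::{banach, second_countable_topology}"
  assumes h: "integrable lborel h" and M: "finite M" "M \<subseteq> int_lattice"
    and supp: "\<And>x. h x \<noteq> 0 \<Longrightarrow> nearest x \<in> M"
  shows "\<And>m. set_integrable lborel unit_cell (\<lambda>x. h (x + m))"
    and "(LINT x|lborel. h x) = (\<Sum>m\<in>M. LINT x:unit_cell|lborel. h (x + m))"
proof -
  have meas: "h \<in> borel_measurable borel"
    using h by (simp add: borel_measurable_integrable)
  show "set_integrable lborel unit_cell (\<lambda>x. h (x + m))" for m
    unfolding set_integrable_def
    using integrable_lborel_translate[OF h] by (intro integrable_mult_indicator) auto
  have int: "integrable lborel (\<lambda>x. indicator unit_cell (x - m) *\<^sub>R h x)" for m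
  proof -
    have "{x. x - m \<in> unit_cell} \<in> sets lborel"
      using borel_unit_cell by measurable
    from integrable_mult_indicator[OF this h] show ?thesis
      by (simp add: indicator_def)
  qed
  have eq: "h x = (\<Sum>m\<in>M. indicator unit_cell (x - m) *\<^sub>R h x)" for x
    using sum_indicator_unit_cell[OF M supp] by (cases "h x = 0") (auto simp flip: scaleR_sum_left)
  have "(LINT x|lborel. h x) = (LINT x|lborel. (\<Sum>m\<in>M. indicator unit_cell (x - m) *\<^sub>R h x))"
    using eq by metis
  also have "\<dots> = (\<Sum>m\<in>M. LINT x|lborel. indicator unit_cell (x - m) *\<^sub>R h x)"
    using int by (intro Bochner_Integration.integral_sum) auto
  also have "\<dots> = (\<Sum>m\<in>M. LINT x:unit_cell|lborel. h (x + m))"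
  proof (intro sum.cong refl)
    fix m
    show "(LINT x|lborel. indicator unit_cell (x - m) *\<^sub>R h x) = (LINT x:unit_cell|lborel. h (x + m))"
      using lborel_integral_translate[of "\<lambda>x. indicator unit_cell (x - m) *\<^sub>R h x" m]
        borel_measurable_integrable[OF int]
      by (simp add: set_lebesgue_integral_def)
  qed
  finally show "(LINT x|lborel. h x) = (\<Sum>m\<in>M. LINT x:unit_cell|lborel. h (x + m))" .
qed

text \<open>The translated cell is cut along the lattice cells. Periodicity moves the pieces back
  into the unit cell, which they fill exactly once.\<close>

lemma integral_unit_cell_shift:
  fixes h :: "real^'d \<Rightarrow> complex"
  assumes meas [measurable]: "h \<in> borel_measurable borel" and bdd: "\<And>x. cmod (h x) \<le> K"
    and per: "\<And>x m. m \<in> int_lattice \<Longrightarrow> h (x + m) = h x"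
  shows "(LINT x:unit_cell|lborel. h (x + t)) = (LINT x:unit_cell|lborel. h x)"
proof -
  let ?g = "\<lambda>x. indicator unit_cell (x - t) *\<^sub>R h x"
  obtain L :: nat where L: "norm t + 1 \<le> real L"
    using real_arch_simple by blast
  define M :: "(real^'d) set" where "M = lattice_box (Suc (Suc L))"
  have M: "finite M" "M \<subseteq> int_lattice"
    unfolding M_def by (rule finite_lattice_box lattice_box_subset)+
  have near: "nearest y \<in> M" if "\<And>j. \<bar>y $ j\<bar> \<le> real (Suc L)" for y
    using nearest_in_lattice_box[OF that] by (simp add: M_def)
  have tj: "\<bar>t $ j\<bar> \<le> real L - 1" for j
    using component_le_norm_cart[of t j] L by linarith
  have supp: "nearest x \<in> M" if "?g x \<noteq> 0" for x
  proof (rule near)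
    fix j
    have "x - t \<in> unit_cell"
      using that by (auto simp: indicator_def split: if_splits)
    then have "- 1/2 \<le> x $ j - t $ j \<and> x $ j - t $ j < 1/2"
      by (auto simp: unit_cell_def)
    with tj[of j] show "\<bar>x $ j\<bar> \<le> real (Suc L)"
      by auto
  qed
  have int: "integrable lborel ?g"
  proof -
    have "integrable lborel (\<lambda>x. indicator unit_cell x *\<^sub>R h (x + t))"
      using integrable_unit_cell[of "\<lambda>x. h (x + t)" K] bdd by (simp add: set_integrable_def)
    from integrable_lborel_translate[OF this, of "- t"] show ?thesis
      by simp
  qed
  have uminus: "(\<Sum>m\<in>M. indicator unit_cell (x + m - t)) = (1::real)" if "x \<in> unit_cell" for x
  proof -
    \<comment> \<open>\<open>M\<close> is symmetric, so m may be replaced by -m to reach the form of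
      \<open>sum_indicator_unit_cell\<close>.\<close>
    have "(\<Sum>m\<in>M. indicator unit_cell (x + m - t)) = (\<Sum>m\<in>M. indicator unit_cell ((x - t) - m))"
      by (rule sum.reindex_bij_witness[of _ uminus uminus])
        (auto simp: M_def lattice_box_uminus algebra_simps)
    also have "\<dots> = (1::real)"
    proof (intro sum_indicator_unit_cell M near)
      fix j
      have "- 1/2 \<le> x $ j \<and> x $ j < 1/2"
        using that by (auto simp: unit_cell_def)
      with tj[of j] show "\<bar>(x - t) $ j\<bar> \<le> real (Suc L)"
        by auto
    qed
    finally show ?thesis .
  qed
  have "(LINT x:unit_cell|lborel. h (x + t)) = (LINT x|lborel. ?g x)"
    using lborel_integral_translate[of ?g t] borel_measurable_integrable[OF int]
    by (simp add: set_lebesgue_integral_def)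
  also have "\<dots> = (\<Sum>m\<in>M. LINT x:unit_cell|lborel. ?g (x + m))"
    by (rule integral_eq_sum_unit_cells(2)[OF int M supp])
  also have "\<dots> = (\<Sum>m\<in>M. LINT x|lborel. indicator unit_cell x *\<^sub>R (indicator unit_cell (x + m - t) *\<^sub>R h x))"
    using M per by (intro sum.cong) (auto simp: set_lebesgue_integral_def)
  also have "\<dots> = (LINT x|lborel. (\<Sum>m\<in>M. indicator unit_cell x *\<^sub>R (indicator unit_cell (x + m - t) *\<^sub>R h x)))"
  proof (rule Bochner_Integration.integral_sum[symmetric])
    fix m assume "m \<in> M"
    then show "integrable lborel (\<lambda>x. indicator unit_cell x *\<^sub>R (indicator unit_cell (x + m - t) *\<^sub>R h x))"
      using integral_eq_sum_unit_cells(1)[OF int M supp, of m] per M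
      by (auto simp: set_integrable_def)
  qed
  also have "\<dots> = (LINT x|lborel. indicator unit_cell x *\<^sub>R h x)"
  proof (intro Bochner_Integration.integral_cong refl)
    fix x
    show "(\<Sum>m\<in>M. indicator unit_cell x *\<^sub>R (indicator unit_cell (x + m - t) *\<^sub>R h x)) = indicator unit_cell x *\<^sub>R h x"
      using uminus[of x] by (cases "x \<in> unit_cell") (auto simp flip: scaleR_sum_left)
  qed
  finally show ?thesis
    by (simp add: set_lebesgue_integral_def)
qed

text \<open>If k has a nonzero coordinate j, a shift by half a period along j changes the sign of
  the character but, by periodicity, not its integral.\<close>

lemma integral_unit_cell_char:
  assumes k: "k \<in> int_lattice"
  shows "(LINT x:unit_cell|lborel. char k x) = (if k = 0 then 1 else 0)"
proof (cases "k = 0")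
  case True
  then show ?thesis
    using integral_unit_cell_const[of 1] by simp
next
  case False
  then obtain j where j: "k $ j \<noteq> 0"
    by (auto simp: vec_eq_iff)
  define t where "t = axis j (1 / (2 * k $ j))"
  have "char k t = -1"
    using j by (simp add: char_def t_def inner_axis)
  then have "char k (x + t) = - char k x" for x
    by (simp add: char_add_right)
  moreover have "(LINT x:unit_cell|lborel. char k (x + t)) = (LINT x:unit_cell|lborel. char k x)"
    by (rule integral_unit_cell_shift[where K = 1]) (auto simp: char_add_right char_lattice k)
  ultimately have "- (LINT x:unit_cell|lborel. char k x) = (LINT x:unit_cell|lborel. char k x)"
    by (simp add: set_lebesgue_integral_def)
  then show ?thesis
    using False by simp
qed

lemma integral_unit_cell_char_cnj:
  assumes "m \<in> int_lattice" "k \<in> int_lattice"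
  shows "(LINT x:unit_cell|lborel. char m x * cnj (char k x)) = (if m = k then 1 else 0)"
proof -
  have "char m x * cnj (char k x) = char (m - k) x" for x
    using char_add_left[of m "- k" x] by (simp add: cnj_char)
  then show ?thesis
    using integral_unit_cell_char[OF int_lattice_diff[OF assms]] by auto
qed

subsection \<open>Trigonometric polynomials\<close>

definition trig_poly :: "(real^'d \<Rightarrow> complex) \<Rightarrow> bool" where
  "trig_poly p \<longleftrightarrow> (\<exists>A a. finite A \<and> A \<subseteq> int_lattice \<and> p = (\<lambda>x. \<Sum>m\<in>A. a m * char m x))"

lemma trig_poly_char: "m \<in> int_lattice \<Longrightarrow> trig_poly (char m)"
  unfolding trig_poly_def by (intro exI[of _ "{m}"] exI[of _ "\<lambda>_. 1"]) auto

lemma trig_poly_char_mult: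
  assumes "m \<in> int_lattice" "trig_poly p"
  shows "trig_poly (\<lambda>x. char m x * p x)"
proof -
  obtain A a where A: "finite A" "A \<subseteq> int_lattice" and p: "p = (\<lambda>x. \<Sum>k\<in>A. a k * char k x)"
    using assms(2) by (auto simp: trig_poly_def)
  have "char m x * p x = (\<Sum>k\<in>(+) m ` A. a (k - m) * char k x)" for x
    by (simp add: p sum.reindex char_add_left sum_distrib_left mult_ac)
  moreover have "(+) m ` A \<subseteq> int_lattice"
    using A assms(1) by (auto intro: int_lattice_add)
  ultimately show ?thesis
    unfolding trig_poly_def using A(1)
    by (intro exI[of _ "(+) m ` A"] exI[of _ "\<lambda>k. a (k - m)"]) auto
qed

lemma trig_poly_cmult:
  assumes "trig_poly p"
  shows "trig_poly (\<lambda>x. c * p x)"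
proof -
  obtain A a where A: "finite A" "A \<subseteq> int_lattice" and p: "p = (\<lambda>x. \<Sum>k\<in>A. a k * char k x)"
    using assms by (auto simp: trig_poly_def)
  then show ?thesis
    unfolding trig_poly_def
    by (intro exI[of _ A] exI[of _ "\<lambda>k. c * a k"]) (auto simp: sum_distrib_left mult_ac)
qed

lemma trig_poly_add:
  assumes "trig_poly p" "trig_poly q"
  shows "trig_poly (\<lambda>x. p x + q x)"
proof -
  obtain A a where A: "finite A" "A \<subseteq> int_lattice" and p: "p = (\<lambda>x. \<Sum>k\<in>A. a k * char k x)"
    using assms by (auto simp: trig_poly_def)
  obtain B b where B: "finite B" "B \<subseteq> int_lattice" and q: "q = (\<lambda>x. \<Sum>k\<in>B. b k * char k x)"
    using assms by (auto simp: trig_poly_def)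
  have "p x = (\<Sum>k\<in>A \<union> B. (if k \<in> A then a k else 0) * char k x)" for x
    unfolding p using A(1) B(1) by (intro sum.mono_neutral_cong_left) auto
  moreover have "q x = (\<Sum>k\<in>A \<union> B. (if k \<in> B then b k else 0) * char k x)" for x
    unfolding q using A(1) B(1) by (intro sum.mono_neutral_cong_left) auto
  ultimately have "(\<lambda>x. p x + q x) =
      (\<lambda>x. \<Sum>k\<in>A \<union> B. ((if k \<in> A then a k else 0) + (if k \<in> B then b k else 0)) * char k x)"
    by (intro ext) (simp only: sum.distrib distrib_right)
  then show ?thesis
    unfolding trig_poly_def using A B
    by (intro exI[of _ "A \<union> B"]
        exI[of _ "\<lambda>k. (if k \<in> A then a k else 0) + (if k \<in> B then b k else 0)"]) auto
qed

lemma trig_poly_sum: "(\<And>i. i \<in> I \<Longrightarrow> trig_poly (p i)) \<Longrightarrow> trig_poly (\<lambda>x. \<Sum>i\<in>I. p i x)"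
proof (induction I rule: infinite_finite_induct)
  case (insert i I)
  then show ?case
    using trig_poly_add[of "p i" "\<lambda>x. \<Sum>i\<in>I. p i x"] by simp
qed (use trig_poly_cmult[OF trig_poly_char[OF int_lattice_0], of 0] in simp_all)

lemma trig_poly_mult:
  assumes "trig_poly p" "trig_poly q"
  shows "trig_poly (\<lambda>x. p x * q x)"
proof -
  obtain A a where A: "A \<subseteq> int_lattice" and p: "p = (\<lambda>x. \<Sum>k\<in>A. a k * char k x)"
    using assms by (auto simp: trig_poly_def)
  have "trig_poly (\<lambda>x. \<Sum>k\<in>A. a k * (char k x * q x))"
    using A assms(2) by (intro trig_poly_sum trig_poly_cmult trig_poly_char_mult) auto
  then show ?thesis
    by (simp add: p sum_distrib_right mult.assoc)
qed

lemma trig_poly_const: "trig_poly (\<lambda>_. c)"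
  using trig_poly_cmult[OF trig_poly_char[OF int_lattice_0], of c] by simp

lemma trig_poly_power: "trig_poly p \<Longrightarrow> trig_poly (\<lambda>x. p x ^ n)"
  by (induction n) (auto intro: trig_poly_const trig_poly_mult)

lemma trig_poly_cos:
  fixes j :: "'d::finite"
  shows "trig_poly (\<lambda>x. complex_of_real (cos (2 * pi * (x :: real^'d) $ j)))"
proof -
  have "complex_of_real (cos (2 * pi * x $ j)) = 1/2 * (char (axis j 1) x + char (- axis j 1) x)" for x :: "real^'d"
    by (auto simp: char_def inner_axis' complex_eq_iff)
  then show ?thesis
    by (simp only:) (intro trig_poly_cmult trig_poly_add trig_poly_char int_lattice_uminus int_lattice_axis)
qed

lemma integral_unit_cell_coeff:
  assumes A: "finite A" "A \<subseteq> int_lattice" and k: "k \<in> int_lattice"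
  shows "(LINT x:unit_cell|lborel. (\<Sum>m\<in>A. a m * char m x) * cnj (char k x)) = (if k \<in> A then a k else 0)"
proof -
  have eq: "(\<Sum>m\<in>A. a m * char m x) * cnj (char k x) = (\<Sum>m\<in>A. a m * (char m x * cnj (char k x)))" for x
    by (simp add: sum_distrib_right mult.assoc)
  have "set_integrable lborel unit_cell (\<lambda>x. a m * (char m x * cnj (char k x)))" for m
    by (rule integrable_unit_cell[where K = "cmod (a m)"]) (auto simp: norm_mult cnj_char)
  then have "(LINT x:unit_cell|lborel. (\<Sum>m\<in>A. a m * (char m x * cnj (char k x))))
      = (\<Sum>m\<in>A. LINT x:unit_cell|lborel. a m * (char m x * cnj (char k x)))"
    unfolding set_lebesgue_integral_def set_integrable_def scaleR_sum_right
    by (intro Bochner_Integration.integral_sum) auto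
  also have "\<dots> = (\<Sum>m\<in>A. a m * (if m = k then 1 else 0))"
    using A k integral_unit_cell_char_cnj[of _ k] by (intro sum.cong) (auto simp del: char_0)
  also have "\<dots> = (if k \<in> A then a k else 0)"
    using A(1) by (simp add: if_distrib cong: if_cong)
  finally show ?thesis
    by (simp only: eq)
qed

lemma parseval_unit_cell:
  fixes a :: "real^'d \<Rightarrow> complex"
  assumes A: "finite A" "A \<subseteq> int_lattice"
  defines "P \<equiv> \<lambda>x. \<Sum>m\<in>A. a m * char m x"
  shows "(LINT x:unit_cell|lborel. (cmod (P x))\<^sup>2) = (\<Sum>m\<in>A. (cmod (a m))\<^sup>2)"
proof -
  have bound: "cmod (P x) \<le> (\<Sum>m\<in>A. cmod (a m))" for x
    unfolding P_def by (rule order_trans[OF norm_sum]) (simp add: norm_mult)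
  have eq: "complex_of_real ((cmod (P x))\<^sup>2) = (\<Sum>k\<in>A. cnj (a k) * (P x * cnj (char k x)))" for x
    unfolding complex_norm_square
    by (subst (2) P_def) (simp add: sum_distrib_left mult_ac)
  have int: "set_integrable lborel unit_cell (\<lambda>x. cnj (a k) * (P x * cnj (char k x)))" for k
    by (rule integrable_unit_cell[where K = "cmod (a k) * (\<Sum>m\<in>A. cmod (a m))"])
      (use bound in \<open>auto simp: norm_mult cnj_char P_def intro!: mult_left_mono\<close>)
  have "complex_of_real (LINT x:unit_cell|lborel. (cmod (P x))\<^sup>2)
      = (LINT x:unit_cell|lborel. complex_of_real ((cmod (P x))\<^sup>2))"
    unfolding set_lebesgue_integral_def
    by (simp add: scaleR_conv_of_real flip: integral_complex_of_real of_real_mult of_real_power)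
  also have "\<dots> = (\<Sum>k\<in>A. LINT x:unit_cell|lborel. cnj (a k) * (P x * cnj (char k x)))"
    unfolding eq using int unfolding set_lebesgue_integral_def set_integrable_def scaleR_sum_right
    by (intro Bochner_Integration.integral_sum) auto
  also have "\<dots> = (\<Sum>k\<in>A. cnj (a k) * a k)"
  proof (intro sum.cong refl)
    fix k assume "k \<in> A"
    then show "(LINT x:unit_cell|lborel. cnj (a k) * (P x * cnj (char k x))) = cnj (a k) * a k"
      using integral_unit_cell_coeff[OF A, of k a] A(2) by (auto simp: P_def)
  qed
  also have "\<dots> = complex_of_real (\<Sum>m\<in>A. (cmod (a m))\<^sup>2)"
    by (simp add: complex_norm_square mult.commute flip: of_real_power)
  finally show ?thesis
    by (simp only: of_real_eq_iff)
qed

subsection \<open>Lattice sums and integrals\<close>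

text \<open>Nonnegative, equal to 1 exactly at the lattice points: its powers concentrate there.\<close>

definition peak :: "real^'d \<Rightarrow> real" where
  "peak x = (\<Sum>j\<in>UNIV. (1 + cos (2 * pi * x $ j)) / 2) / real CARD('d)"

lemma continuous_on_peak [continuous_intros]: "continuous_on S peak"
  unfolding peak_def[abs_def] by (intro continuous_intros) auto

lemma borel_measurable_peak [measurable]: "peak \<in> borel_measurable borel"
  by (intro borel_measurable_continuous_onI continuous_on_peak)

lemma peak_nonneg: "0 \<le> peak x"
proof -
  have "0 \<le> 1 + cos (2 * pi * x $ j)" for j
    using cos_ge_minus_one[of "2 * pi * x $ j"] by linarith
  then show ?thesis
    unfolding peak_def by (intro divide_nonneg_nonneg sum_nonneg) auto
qed

lemma peak_le_1: "peak (x :: real^'d) \<le> 1"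
proof -
  have "(\<Sum>j\<in>(UNIV :: 'd set). (1 + cos (2 * pi * x $ j)) / 2) \<le> (\<Sum>j\<in>(UNIV :: 'd set). 1)"
  proof (rule sum_mono)
    fix j
    show "(1 + cos (2 * pi * x $ j)) / 2 \<le> 1"
      by simp
  qed
  then show ?thesis
    by (simp add: peak_def divide_le_eq)
qed

lemma peak_0 [simp]: "peak 0 = 1"
  by (simp add: peak_def)

lemma peak_eq_1D:
  fixes x :: "real^'d"
  assumes "peak x = 1" "\<And>j. \<bar>x $ j\<bar> \<le> 1/2"
  shows "x = 0"
proof -
  have "(\<Sum>j\<in>(UNIV :: 'd set). 1 - (1 + cos (2 * pi * x $ j)) / 2) = 0"
    using assms(1) by (simp add: peak_def sum_subtractf divide_eq_eq)
  moreover have "0 \<le> 1 - (1 + cos (2 * pi * x $ j)) / 2" for j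
    by (simp add: divide_le_eq)
  ultimately have "1 - (1 + cos (2 * pi * x $ j)) / 2 = 0" for j
    by (subst (asm) sum_nonneg_eq_0_iff) auto
  then have c: "cos (2 * pi * x $ j) = 1" for j
    by (simp add: field_simps)
  have "x $ j = 0" for j
  proof -
    obtain n :: int where "2 * pi * x $ j = of_int n * 2 * pi"
      using c[of j] cos_one_2pi_int[of "2 * pi * x $ j"] by auto
    then have n: "x $ j = of_int n"
      by simp
    then have "\<bar>real_of_int n\<bar> \<le> 1/2"
      using assms(2)[of j] by simp
    then have "n = 0"
      by linarith
    with n show ?thesis by simp
  qed
  then show ?thesis
    by (simp add: vec_eq_iff)
qed

lemma trig_poly_peak_power: "trig_poly (\<lambda>x::real^'d. complex_of_real (peak x ^ N))"
proof -
  have "complex_of_real (peak x) =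
      (1 / of_nat CARD('d)) * (\<Sum>j\<in>UNIV. 1/2 * (1 + complex_of_real (cos (2 * pi * x $ j))))" for x :: "real^'d"
    by (simp add: peak_def)
  then have "trig_poly (\<lambda>x::real^'d. complex_of_real (peak x))"
    by (simp only:) (intro trig_poly_cmult trig_poly_sum trig_poly_add trig_poly_const trig_poly_cos)
  from trig_poly_power[OF this, of N] show ?thesis
    by simp
qed

text \<open>On the compact remainder of the closed cell \<open>peak\<close> attains its maximum, and
  by \<open>peak_eq_1D\<close> this maximum is not 1.\<close>

lemma norm_ge_imp_peak_le:
  fixes \<eta> :: real
  assumes "\<eta> > 0"
  obtains \<rho> where "0 \<le> \<rho>" "\<rho> < 1"
    "\<And>x::real^'d. x \<in> unit_cell \<Longrightarrow> \<eta> \<le> norm x \<Longrightarrow> peak x \<le> \<rho>"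
proof -
  define K :: "(real^'d) set" where "K = cbox (\<chi> j. -1/2) (\<chi> j. 1/2) - ball 0 \<eta>"
  have "compact K"
    unfolding K_def by (intro compact_diff) auto
  have sub: "x \<in> K" if "x \<in> unit_cell" "\<eta> \<le> norm x" for x
    using that unit_cell_subset_cbox by (auto simp: K_def)
  show thesis
  proof (cases "K = {}")
    case True
    then show ?thesis
      using sub by (intro that[of 0]) auto
  next
    case False
    then obtain x where x: "x \<in> K" "\<And>y. y \<in> K \<Longrightarrow> peak y \<le> peak x"
      using continuous_attains_sup[OF \<open>compact K\<close> False continuous_on_peak] by blast
    have "peak x \<noteq> 1"
    proof
      assume "peak x = 1"
      moreover have "\<bar>x $ j\<bar> \<le> 1/2" for j
      proof -
        have "x \<in> cbox (\<chi> j. -1/2) (\<chi> j. 1/2)"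
          using x(1) by (simp add: K_def)
        then have "-1/2 \<le> x $ j \<and> x $ j \<le> 1/2"
          unfolding mem_box_cart by (metis vec_lambda_beta)
        then show ?thesis
          by (auto simp: abs_le_iff)
      qed
      ultimately have "x = 0"
        by (rule peak_eq_1D)
      then show False
        using x(1) assms by (simp add: K_def)
    qed
    then show ?thesis
      using x sub by (intro that[of "peak x"]) (auto simp: peak_nonneg order_less_le peak_le_1)
  qed
qed

text \<open>Normalized by their means, the powers of \<open>peak\<close> form an approximate
  identity at 0. Away from 0 they are at most \<rho>^N, while the mean is at least \<kappa>
  \<sigma>^N with \<rho> < \<sigma>, so the average of \<open>E\<close> tends to
  \<open>E 0\<close>.\<close>

lemma abs_at_0_le_if_peak_averages_le:
  fixes E :: "real^'d \<Rightarrow> real"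
  assumes meas [measurable]: "E \<in> borel_measurable borel"
    and bdd: "\<And>x. x \<in> unit_cell \<Longrightarrow> \<bar>E x\<bar> \<le> K"
    and cont: "isCont E 0"
    and avg: "\<And>N. \<bar>LINT x:unit_cell|lborel. peak x ^ N * E x\<bar> \<le> b * (LINT x:unit_cell|lborel. peak (x :: real^'d) ^ N)"
  shows "\<bar>E 0\<bar> \<le> b"
proof (rule field_le_epsilon)
  fix \<epsilon> :: real assume "\<epsilon> > 0"
  have zero: "0 \<in> (unit_cell :: (real^'d) set)"
    by (simp add: unit_cell_def)
  have K: "0 \<le> K"
    using bdd[OF zero] by linarith
  have peak_pow: "0 \<le> peak x ^ N" "peak x ^ N \<le> 1" for N and x :: "real^'d"
    by (auto simp: peak_nonneg peak_le_1 power_le_one)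
  obtain \<eta> where \<eta>: "\<eta> > 0" "\<And>x. norm x < \<eta> \<Longrightarrow> \<bar>E x - E 0\<bar> < \<epsilon>"
    using cont \<open>\<epsilon> > 0\<close> unfolding continuous_at_eps_delta by (auto simp: dist_norm)
  obtain \<rho> where \<rho>: "0 \<le> \<rho>" "\<rho> < 1"
    and peak_le: "\<And>x::real^'d. x \<in> unit_cell \<Longrightarrow> \<eta> \<le> norm x \<Longrightarrow> peak x \<le> \<rho>"
    using norm_ge_imp_peak_le[OF \<eta>(1)] by blast
  \<comment> \<open>Any number strictly between \<rho> and 1 serves: the ratio \<rho> / \<sigma> has
    to be below 1, and \<open>peak\<close> has to exceed \<sigma> near 0.\<close>
  define \<sigma> where "\<sigma> = (1 + \<rho>) / 2"
  have \<sigma>: "\<rho> < \<sigma>" "\<sigma> < 1" "0 < \<sigma>"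
    using \<rho> by (auto simp: \<sigma>_def)
  have "isCont peak (0 :: real^'d)"
    using continuous_on_peak[of "UNIV :: (real^'d) set"] by (simp add: continuous_on_eq_continuous_at)
  then obtain \<theta>0 where \<theta>0: "\<theta>0 > 0" "\<And>x::real^'d. norm x < \<theta>0 \<Longrightarrow> \<bar>peak x - 1\<bar> < 1 - \<sigma>"
    using \<sigma>(2) unfolding continuous_at_eps_delta by (auto simp: dist_norm dest!: spec[of _ "1 - \<sigma>"])
  \<comment> \<open>The bound 1/2 keeps the ball inside the cell.\<close>
  define \<theta> where "\<theta> = min \<theta>0 (1/2)"
  have \<theta>: "\<theta> > 0"
    using \<theta>0(1) by (simp add: \<theta>_def)
  have ball_sub: "ball (0 :: real^'d) \<theta> \<subseteq> unit_cell"
  proof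
    fix x :: "real^'d" assume "x \<in> ball 0 \<theta>"
    then have "norm x < 1/2"
      by (simp add: \<theta>_def)
    then have "- 1/2 \<le> x $ j \<and> x $ j < 1/2" for j
      using component_le_norm_cart[of x j] by linarith
    then show "x \<in> unit_cell"
      unfolding unit_cell_def by blast
  qed
  have peak_ge: "\<sigma> \<le> peak x" if "x \<in> ball 0 \<theta>" for x :: "real^'d"
    using \<theta>0(2)[of x] that by (simp add: \<theta>_def)
  define \<kappa> where "\<kappa> = measure lborel (ball (0 :: real^'d) \<theta>)"
  have \<kappa>: "\<kappa> > 0"
    using content_ball_pos[OF \<theta>, of "0 :: real^'d"] by (simp add: \<kappa>_def)
  define A where "A N = (LINT x:unit_cell|lborel. (peak (x :: real^'d)) ^ N)" for N :: nat
  have int_pow: "set_integrable lborel unit_cell (\<lambda>x::real^'d. peak x ^ N)" for N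
    by (rule integrable_unit_cell[where K = 1]) (use peak_pow in auto)
  have A_ge: "\<sigma> ^ N * \<kappa> \<le> A N" for N
  proof -
    have "\<sigma> ^ N * \<kappa> = (LINT x|lborel. indicator (ball (0 :: real^'d) \<theta>) x *\<^sub>R \<sigma> ^ N)"
      by (simp add: \<kappa>_def)
    also have "\<dots> \<le> (LINT x|lborel. indicator unit_cell x *\<^sub>R (peak (x :: real^'d)) ^ N)"
    proof (rule integral_mono)
      show "integrable lborel (\<lambda>x::real^'d. indicator (ball (0 :: real^'d) \<theta>) x *\<^sub>R \<sigma> ^ N)"
        by (rule integrableI_bounded_set_indicator[where B = "\<sigma> ^ N"])
          (use \<sigma>(3) emeasure_lborel_ball_finite[of "0::real^'d" \<theta>] in auto)
      show "integrable lborel (\<lambda>x::real^'d. indicator unit_cell x *\<^sub>R peak x ^ N)"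
        using int_pow[of N] by (simp add: set_integrable_def)
      show "indicator (ball 0 \<theta>) x *\<^sub>R \<sigma> ^ N \<le> indicator unit_cell x *\<^sub>R peak x ^ N" for x :: "real^'d"
        using ball_sub peak_pow[of x N] power_mono[OF peak_ge, of x N] \<sigma>(3)
        by (auto simp: indicator_def)
    qed
    finally show ?thesis
      by (simp add: A_def set_lebesgue_integral_def)
  qed
  have A_pos: "A N > 0" for N
    using A_ge[of N] \<sigma>(3) \<kappa> by (meson less_le_trans mult_pos_pos zero_less_power)
  have main: "\<bar>E 0\<bar> * A N \<le> b * A N + \<epsilon> * A N + 2 * K * \<rho> ^ N" for N
  proof -
    have int_E: "set_integrable lborel unit_cell (\<lambda>x. peak x ^ N * E x)"
    proof (rule integrable_unit_cell[where K = K])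
      fix x :: "real^'d" assume x: "x \<in> unit_cell"
      have "\<bar>peak x ^ N\<bar> * \<bar>E x\<bar> \<le> 1 * K"
        using peak_pow[of x N] bdd[OF x] by (intro mult_mono) auto
      then show "norm (peak x ^ N * E x) \<le> K"
        by (simp add: abs_mult)
    qed auto
    have "set_integrable lborel unit_cell (\<lambda>x. E 0 * peak x ^ N - peak x ^ N * E x)"
      using int_E int_pow[of N] by (intro set_integral_diff set_integrable_mult_right) auto
    then have int_diff: "set_integrable lborel unit_cell (\<lambda>x. peak x ^ N * (E 0 - E x))"
      by (simp add: algebra_simps)
    have "E 0 * A N - (LINT x:unit_cell|lborel. peak x ^ N * E x)
        = (LINT x:unit_cell|lborel. E 0 * peak (x :: real^'d) ^ N) - (LINT x:unit_cell|lborel. peak x ^ N * E x)"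
      by (simp add: A_def)
    also have "\<dots> = (LINT x:unit_cell|lborel. E 0 * peak x ^ N - peak x ^ N * E x)"
      using int_E int_pow[of N] by (subst set_integral_diff(2)) auto
    also have "\<dots> = (LINT x:unit_cell|lborel. peak x ^ N * (E 0 - E x))"
      by (simp add: algebra_simps)
    also have "\<bar>\<dots>\<bar> \<le> (LINT x:unit_cell|lborel. \<epsilon> * peak (x :: real^'d) ^ N + 2 * K * \<rho> ^ N)"
      unfolding real_norm_def[symmetric]
    proof (rule set_integral_norm_le[OF int_diff])
      show "set_integrable lborel unit_cell (\<lambda>x::real^'d. \<epsilon> * peak x ^ N + 2 * K * \<rho> ^ N)"
        by (rule integrable_unit_cell[where K = "\<epsilon> + 2 * K * \<rho> ^ N"])
          (use peak_pow \<open>\<epsilon> > 0\<close> K \<rho> in \<open>auto intro!: mult_left_le\<close>)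
      fix x :: "real^'d" assume x: "x \<in> unit_cell"
      \<comment> \<open>Near 0 the difference is below \<epsilon>; elsewhere it is at most 2 K, but
        \<open>peak\<close> is at most \<rho>. Keeping both terms on the right gives one bound for
        the whole cell.\<close>
      have "peak x ^ N * \<bar>E 0 - E x\<bar> \<le> \<epsilon> * peak x ^ N + 2 * K * \<rho> ^ N"
      proof (cases "norm x < \<eta>")
        case True
        then have "peak x ^ N * \<bar>E 0 - E x\<bar> \<le> peak x ^ N * \<epsilon>"
          using \<eta>(2)[of x] peak_pow[of x N] by (intro mult_left_mono) auto
        moreover have "0 \<le> 2 * K * \<rho> ^ N"
          using K \<rho> by simp
        ultimately show ?thesis
          using mult.commute[of \<epsilon> "peak x ^ N"] by linarith
      next
        case False
        then have "peak x ^ N \<le> \<rho> ^ N"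
          using peak_le[OF x] by (intro power_mono peak_nonneg) auto
        moreover have "\<bar>E 0 - E x\<bar> \<le> 2 * K"
          using bdd[OF x] bdd[OF zero] by linarith
        ultimately have "peak x ^ N * \<bar>E 0 - E x\<bar> \<le> \<rho> ^ N * (2 * K)"
          using \<rho> by (intro mult_mono) auto
        moreover have "0 \<le> \<epsilon> * peak x ^ N"
          using \<open>\<epsilon> > 0\<close> peak_pow[of x N] by simp
        ultimately show ?thesis
          using mult.commute[of "2 * K" "\<rho> ^ N"] by linarith
      qed
      then show "norm (peak x ^ N * (E 0 - E x)) \<le> \<epsilon> * peak x ^ N + 2 * K * \<rho> ^ N"
        using peak_pow[of x N] by (simp add: abs_mult)
    qed
    also have "(LINT x:unit_cell|lborel. \<epsilon> * (peak (x :: real^'d)) ^ N + 2 * K * \<rho> ^ N) = \<epsilon> * A N + 2 * K * \<rho> ^ N"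
    proof -
      have "set_integrable lborel unit_cell (\<lambda>x::real^'d. 2 * K * \<rho> ^ N)"
        by (rule integrable_unit_cell[where K = "2 * K * \<rho> ^ N"]) (use K \<rho> in auto)
      then show ?thesis
        using int_pow[of N] unfolding A_def
        by (subst set_integral_add(2)) (auto simp: set_lebesgue_integral_def measure_def emeasure_unit_cell)
    qed
    finally have "\<bar>E 0 * A N - (LINT x:unit_cell|lborel. peak x ^ N * E x)\<bar> \<le> \<epsilon> * A N + 2 * K * \<rho> ^ N" .
    moreover have "\<bar>LINT x:unit_cell|lborel. peak x ^ N * E x\<bar> \<le> b * A N"
      using avg[of N] by (simp add: A_def)
    moreover have "\<bar>E 0\<bar> * A N = \<bar>E 0 * A N\<bar>"
      using A_pos[of N] by (simp add: abs_mult)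
    ultimately show ?thesis
      by linarith
  qed
  have "\<bar>E 0\<bar> \<le> b + \<epsilon> + 2 * K / \<kappa> * (\<rho> / \<sigma>) ^ N" for N
  proof -
    have "\<bar>E 0\<bar> \<le> b + \<epsilon> + 2 * K * \<rho> ^ N / A N"
      using main[of N] A_pos[of N] by (simp add: field_simps)
    also have "2 * K * \<rho> ^ N / A N \<le> 2 * K * \<rho> ^ N / (\<sigma> ^ N * \<kappa>)"
      using A_ge[of N] A_pos[of N] K \<rho> \<sigma> \<kappa> by (intro divide_left_mono) auto
    also have "\<dots> = 2 * K / \<kappa> * (\<rho> / \<sigma>) ^ N"
      by (simp add: power_divide)
    finally show ?thesis by simp
  qed
  moreover have "(\<lambda>N. b + \<epsilon> + 2 * K / \<kappa> * (\<rho> / \<sigma>) ^ N) \<longlonglongrightarrow> b + \<epsilon> + 2 * K / \<kappa> * 0"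
    using \<rho> \<sigma> by (intro tendsto_intros LIMSEQ_realpow_zero) auto
  ultimately show "\<bar>E 0\<bar> \<le> b + \<epsilon>"
    by (intro LIMSEQ_le_const) auto
qed

lemma trig_poly_periodic:
  assumes "trig_poly p" "k \<in> int_lattice"
  shows "p (x + k) = p x"
  using assms by (auto simp: trig_poly_def char_add_right char_lattice subset_iff intro!: sum.cong)

lemma integrable_continuous_box_support:
  fixes f :: "real^'d \<Rightarrow> 'b::euclidean_space"
  assumes "continuous_on UNIV f" and "\<And>x. f x \<noteq> 0 \<Longrightarrow> x \<in> cbox a b"
  shows "integrable lborel f"
proof -
  have "integrable lborel (\<lambda>x. indicator (cbox a b) x *\<^sub>R f x)"
    using assms(1) by (intro borel_integrable_compact) (auto intro: continuous_on_subset)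
  moreover have "(\<lambda>x. indicator (cbox a b) x *\<^sub>R f x) = f"
    using assms(2) by (auto simp: fun_eq_iff indicator_def)
  ultimately show ?thesis by simp
qed

text \<open>A quantitative form of the Poisson summation formula. Averaging the periodization of \<open>F\<close>
  against \<open>peak\<^sup>N\<close>, a trigonometric polynomial whose coefficients are bounded by its mean, only
  involves finitely many Fourier coefficients of \<open>F\<close>.\<close>

lemma lattice_sum_minus_integral_le:
  fixes F :: "real^'d \<Rightarrow> real"
  assumes cont: "continuous_on UNIV F" and supp: "\<And>x j. F x \<noteq> 0 \<Longrightarrow> \<bar>x $ j\<bar> \<le> real L"
    and b: "\<And>A. finite A \<Longrightarrow> A \<subseteq> int_lattice - {0} \<Longrightarrow>
      (\<Sum>m\<in>A. cmod (LINT x|lborel. complex_of_real (F x) * char m x)) \<le> b"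
  shows "\<bar>(\<Sum>\<^sub>\<infinity>m\<in>int_lattice. F m) - (LINT x|lborel. F x)\<bar> \<le> b"
proof -
  define M :: "(real^'d) set" where "M = lattice_box (Suc L)"
  have M: "finite M" "M \<subseteq> int_lattice"
    unfolding M_def by (rule finite_lattice_box lattice_box_subset)+
  have near: "nearest x \<in> M" if "F x \<noteq> 0" for x
    unfolding M_def using supp[OF that] by (rule nearest_in_lattice_box)
  have meas [measurable]: "F \<in> borel_measurable borel"
    by (rule borel_measurable_continuous_onI[OF cont])
  define I where "I = (LINT x|lborel. F x)"
  \<comment> \<open>On the unit cell this is the full periodization of \<open>F\<close> minus its
    mean, since \<open>M\<close> contains every lattice point m with \<open>F (w + m)\<close>
    nonzero there. At 0 it is the error to be bounded.\<close>
  define E where "E w = (\<Sum>m\<in>M. F (w + m)) - I" for w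
  have supp_box: "x \<in> cbox (\<chi> j. - real L) (\<chi> j. real L)" if "F x \<noteq> 0" for x
    using supp[OF that] by (auto simp: mem_box_cart abs_le_iff minus_le_iff)
  have F_zero: "F m = 0" if "m \<in> int_lattice" "m \<notin> M" for m
  proof (rule ccontr)
    assume "F m \<noteq> 0"
    then have "\<bar>m $ j\<bar> \<le> real (Suc L)" for j
      using supp[of m j] by simp
    with that show False
      by (auto simp: M_def lattice_box_def)
  qed
  have "(\<Sum>\<^sub>\<infinity>m\<in>int_lattice. F m) = (\<Sum>\<^sub>\<infinity>m\<in>M. F m)"
    using F_zero M(2) by (intro infsum_cong_neutral) auto
  also have "\<dots> = (\<Sum>m\<in>M. F m)"
    using M(1) by simp
  finally have E0: "E 0 = (\<Sum>\<^sub>\<infinity>m\<in>int_lattice. F m) - (LINT x|lborel. F x)"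
    by (simp add: E_def I_def)
  have contE: "continuous_on UNIV E"
    unfolding E_def by (intro continuous_intros continuous_on_compose2[OF cont]) auto
  have "compact (E ` cbox (\<chi> j. -1/2) (\<chi> j. 1/2))"
    by (intro compact_continuous_image continuous_on_subset[OF contE]) auto
  then have "bounded (E ` cbox (\<chi> j. -1/2) (\<chi> j. 1/2))"
    by (rule compact_imp_bounded)
  then obtain K where K: "\<And>x. x \<in> cbox (\<chi> j. -1/2) (\<chi> j. 1/2) \<Longrightarrow> \<bar>E x\<bar> \<le> K"
    unfolding bounded_iff real_norm_def by blast
  have measE [measurable]: "E \<in> borel_measurable borel"
    by (rule borel_measurable_continuous_onI[OF contE])
  have "\<bar>E 0\<bar> \<le> b"
  proof (rule abs_at_0_le_if_peak_averages_le[where K = K])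
    show "\<bar>E x\<bar> \<le> K" if "x \<in> unit_cell" for x
      using K that unit_cell_subset_cbox by blast
    show "isCont E 0"
      using contE by (simp add: continuous_on_eq_continuous_at)
    fix N
    let ?p = "\<lambda>x::real^'d. peak x ^ N"
    have p01: "0 \<le> ?p x" "?p x \<le> 1" for x
      by (auto simp: peak_nonneg peak_le_1 power_le_one)
    have contp: "continuous_on UNIV ?p"
      by (intro continuous_intros)
    then have measp [measurable]: "?p \<in> borel_measurable borel"
      by (rule borel_measurable_continuous_onI)
    have per: "?p (x + m) = ?p x" if "m \<in> int_lattice" for x m
      using trig_poly_periodic[OF trig_poly_peak_power[of N] that, of x] of_real_eq_iff by blast
    obtain A a where A: "finite A" "A \<subseteq> int_lattice"
      and p_eq: "\<And>x. complex_of_real (?p x) = (\<Sum>m\<in>A. a m * char m x)"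
      using trig_poly_peak_power[where 'd = 'd and N = N] by (auto simp: trig_poly_def fun_eq_iff)
    define mean where "mean = (LINT x:unit_cell|lborel. ?p x)"
    define c where "c m = (LINT x|lborel. complex_of_real (F x) * char m x)" for m
    have int_p: "set_integrable lborel unit_cell ?p"
      by (rule integrable_unit_cell[where K = 1]) (use p01 in auto)
    have int_Fp: "integrable lborel (\<lambda>x. F x * ?p x)"
      by (rule integrable_continuous_box_support[OF _ supp_box])
        (auto intro!: continuous_intros cont contp)
    have int_Fc: "integrable lborel (\<lambda>x. complex_of_real (F x) * char m x)" for m
      by (rule integrable_continuous_box_support[OF _ supp_box])
        (auto intro!: continuous_intros cont)
    have coeff: "(LINT x:unit_cell|lborel. complex_of_real (?p x) * cnj (char k x))
        = (if k \<in> A then a k else 0)" if "k \<in> int_lattice" for k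
      unfolding p_eq by (rule integral_unit_cell_coeff[OF A that])
    \<comment> \<open>Here the nonnegativity of \<open>peak\<close> is essential: taking absolute
      values inside the coefficient integral removes only the character.\<close>
    have a_le: "cmod (a k) \<le> mean" if "k \<in> A" for k
    proof -
      have "a k = (LINT x:unit_cell|lborel. complex_of_real (?p x) * cnj (char k x))"
        using coeff[of k] that A(2) by auto
      also have "cmod \<dots> \<le> mean"
        unfolding mean_def
      proof (rule set_integral_norm_le[OF _ int_p])
        show "set_integrable lborel unit_cell (\<lambda>x. complex_of_real (?p x) * cnj (char k x))"
          by (rule integrable_unit_cell[where K = 1])
            (use p01 in \<open>auto simp: norm_mult norm_power cnj_char peak_nonneg\<close>)
      qed (auto simp: norm_mult norm_power peak_nonneg)
      finally show ?thesis .
    qed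
    have a0: "complex_of_real mean = (if 0 \<in> A then a 0 else 0)"
    proof -
      have "complex_of_real mean = (LINT x:unit_cell|lborel. complex_of_real (?p x))"
        unfolding mean_def set_lebesgue_integral_def
        by (simp add: scaleR_conv_of_real flip: integral_complex_of_real of_real_mult of_real_power)
      then show ?thesis
        using coeff[of 0] by simp
    qed
    have c0: "c 0 = complex_of_real I"
      by (simp add: c_def I_def)
    have "complex_of_real (LINT x|lborel. F x * ?p x) = (LINT x|lborel. complex_of_real (F x) * complex_of_real (?p x))"
      by (simp flip: integral_complex_of_real of_real_mult of_real_power)
    also have "\<dots> = (LINT x|lborel. (\<Sum>m\<in>A. a m * (complex_of_real (F x) * char m x)))"
      unfolding p_eq by (simp add: sum_distrib_left mult.left_commute)
    also have "\<dots> = (\<Sum>m\<in>A. a m * c m)"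
      unfolding c_def using int_Fc by (subst Bochner_Integration.integral_sum) auto
    \<comment> \<open>Frequency 0 contributes \<open>mean * I\<close>, the average of the constant
      subtracted in \<open>E\<close>, so only nonzero frequencies remain. If \<open>A\<close> omits
      0, then \<open>a0\<close> gives mean 0.\<close>
    also have "\<dots> = complex_of_real mean * c 0 + (\<Sum>m\<in>A - {0}. a m * c m)"
      using A(1) a0 by (cases "0 \<in> A") (auto simp: sum.remove)
    finally have "complex_of_real ((LINT x|lborel. F x * ?p x) - mean * I) = (\<Sum>m\<in>A - {0}. a m * c m)"
      by (simp add: c0)
    then have "\<bar>(LINT x|lborel. F x * ?p x) - mean * I\<bar> = cmod (\<Sum>m\<in>A - {0}. a m * c m)"
      by (metis norm_of_real)
    also have "\<dots> \<le> (\<Sum>m\<in>A - {0}. mean * cmod (c m))"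
      by (rule sum_norm_le) (auto simp: norm_mult intro!: mult_right_mono a_le)
    also have "\<dots> = mean * (\<Sum>m\<in>A - {0}. cmod (c m))"
      by (simp add: sum_distrib_left)
    also have "\<dots> \<le> mean * b"
    proof (rule mult_left_mono)
      show "(\<Sum>m\<in>A - {0}. cmod (c m)) \<le> b"
        unfolding c_def using A by (intro b) auto
      show "0 \<le> mean"
        unfolding mean_def set_lebesgue_integral_def by (intro Bochner_Integration.integral_nonneg) (simp add: p01)
    qed
    finally have 1: "\<bar>(LINT x|lborel. F x * ?p x) - mean * I\<bar> \<le> b * mean"
      by (simp add: mult.commute)
    have near': "nearest x \<in> M" if "F x * ?p x \<noteq> 0" for x
      using that near by auto
    have int_m: "set_integrable lborel unit_cell (\<lambda>x. ?p x * F (x + m))" if "m \<in> M" for m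
      using integral_eq_sum_unit_cells(1)[OF int_Fp M near', of m] that M(2) per by (auto simp: mult.commute)
    have "(LINT x|lborel. F x * ?p x) = (\<Sum>m\<in>M. LINT x:unit_cell|lborel. F (x + m) * ?p (x + m))"
      by (rule integral_eq_sum_unit_cells(2)[OF int_Fp M near'])
    also have "\<dots> = (\<Sum>m\<in>M. LINT x:unit_cell|lborel. ?p x * F (x + m))"
      using M(2) per by (intro sum.cong) (auto simp: mult.commute subset_iff)
    also have "\<dots> = (LINT x:unit_cell|lborel. (\<Sum>m\<in>M. ?p x * F (x + m)))"
      using int_m unfolding set_lebesgue_integral_def set_integrable_def scaleR_sum_right
      by (intro Bochner_Integration.integral_sum[symmetric]) auto
    finally have 2: "(LINT x|lborel. F x * ?p x) = (LINT x:unit_cell|lborel. (\<Sum>m\<in>M. ?p x * F (x + m)))" .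
    have int_sum: "set_integrable lborel unit_cell (\<lambda>x. (\<Sum>m\<in>M. ?p x * F (x + m)))"
      using int_m unfolding set_integrable_def scaleR_sum_right by (intro Bochner_Integration.integrable_sum) auto
    have int_pI: "set_integrable lborel unit_cell (\<lambda>x. I * ?p x)"
      using int_p by (intro set_integrable_mult_right) auto
    have "(LINT x:unit_cell|lborel. ?p x * E x)
        = (LINT x:unit_cell|lborel. (\<Sum>m\<in>M. ?p x * F (x + m)) - I * ?p x)"
      by (simp add: E_def algebra_simps sum_distrib_left)
    also have "\<dots> = (LINT x|lborel. F x * ?p x) - I * mean"
      unfolding 2 mean_def using set_integral_diff(2)[OF int_sum int_pI] by simp
    finally show "\<bar>LINT x:unit_cell|lborel. ?p x * E x\<bar> \<le> b * (LINT x:unit_cell|lborel. ?p x)"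
      using 1 unfolding mean_def by (simp add: mult.commute)
  qed measurable
  then show ?thesis
    by (simp add: E0)
qed

subsection \<open>A Bessel inequality on general lattices\<close>

lemma char_matrix: "char (S *v m) y = char m (transpose S *v y)"
  by (metis char_def dot_lmul_matrix inner_commute transpose_matrix_vector)

lemma integrable_finite_set:
  fixes f :: "'a \<Rightarrow> 'b::{banach, second_countable_topology}"
  assumes "C \<in> sets M" "emeasure M C < \<infinity>" "f \<in> borel_measurable M" "\<And>x. norm (f x) \<le> B"
  shows "set_integrable M C f"
  unfolding set_integrable_def using assms
  by (intro integrableI_bounded_set_indicator[where B = B]) auto

text \<open>Duality: the sum of squares is the integral of \<open>g\<close> against a trigonometric polynomial, and the
  cube, seen in lattice coordinates, is covered by at most \<open>(2L + 3)\<^sup>d\<close> unit cells.\<close>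

lemma bessel_matrix_lattice:
  fixes S :: "real^'d^'d" and g :: "real^'d \<Rightarrow> real"
  assumes S: "invertible S" and C: "C \<in> sets lborel" "emeasure lborel C < \<infinity>"
    and meas [measurable]: "g \<in> borel_measurable borel"
    and g2: "set_integrable lborel C (\<lambda>x. (g x)\<^sup>2)"
    and C_le: "\<And>y j. y \<in> C \<Longrightarrow> \<bar>(transpose S *v y) $ j\<bar> \<le> real L"
    and A: "finite A" "A \<subseteq> int_lattice"
  shows "(\<Sum>m\<in>A. (cmod (LINT y:C|lborel. complex_of_real (g y) * char (S *v m) y))\<^sup>2)
    \<le> real (2 * L + 3) ^ CARD('d) / \<bar>det S\<bar> * (LINT y:C|lborel. (g y)\<^sup>2)"
proof -
  define a where "a m = (LINT y:C|lborel. complex_of_real (g y) * char (S *v m) y)" for m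
  define X where "X = (\<Sum>m\<in>A. (cmod (a m))\<^sup>2)"
  \<comment> \<open>The conjugate coefficients make the pairing of \<open>g\<close> with
    \<open>T\<close> equal to the sum of squares \<open>X\<close>.\<close>
  define P where "P x = (\<Sum>m\<in>A. cnj (a m) * char m x)" for x
  define T where "T y = P (transpose S *v y)" for y
  \<comment> \<open>A bound for the number of cells met by the cube times the volume 1 / \<bar>det
    S\<bar> of a cell in the original coordinates.\<close>
  define c where "c = real (2 * L + 3) ^ CARD('d) / \<bar>det S\<bar>"
  define G where "G = (LINT y:C|lborel. (g y)\<^sup>2)"
  have det: "det S \<noteq> 0"
    using S by (simp add: invertible_det_nz)
  then have c: "c > 0"
    by (simp add: c_def)
  have [measurable]: "C \<in> sets borel" using C by simp
  have lin: "(*v) (transpose S) \<in> borel_measurable borel"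
    by simp
  have measP [measurable]: "P \<in> borel_measurable borel"
    unfolding P_def[abs_def] by measurable
  have measT [measurable]: "T \<in> borel_measurable borel"
    unfolding T_def[abs_def] using lin by measurable
  have P_bdd: "cmod (P x) \<le> (\<Sum>m\<in>A. cmod (a m))" for x
    unfolding P_def by (rule order_trans[OF norm_sum]) (simp add: norm_mult)
  have P2_bdd: "(cmod (P x))\<^sup>2 \<le> (\<Sum>m\<in>A. cmod (a m))\<^sup>2" for x
    by (intro power_mono P_bdd) auto
  have T2_bdd: "(cmod (T y))\<^sup>2 \<le> (\<Sum>m\<in>A. cmod (a m))\<^sup>2" for y
    unfolding T_def by (rule P2_bdd)
  have int_T2: "set_integrable lborel C (\<lambda>y. (cmod (T y))\<^sup>2)"
    by (rule integrable_finite_set[OF C, where B = "(\<Sum>m\<in>A. cmod (a m))\<^sup>2"]) (use T2_bdd in auto)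
  have int_g: "set_integrable lborel C g"
  proof -
    \<comment> \<open>On a set of finite measure, 1 + g^2 is an integrable majorant of
      \<bar>g\<bar>.\<close>
    have "set_integrable lborel C (\<lambda>x. 1 + (g x)\<^sup>2)"
      by (intro set_integral_add(1)[OF _ g2] integrable_finite_set[OF C, where B = 1]) auto
    then show ?thesis
    proof (rule set_integrable_bound)
      show "set_borel_measurable lborel C g"
        unfolding set_borel_measurable_def by measurable
      have "\<bar>t\<bar> \<le> 1 + t\<^sup>2" for t :: real
        using zero_le_power2[of "\<bar>t\<bar> - 1"] by (simp add: power2_eq_square algebra_simps)
      then show "AE x in lborel. x \<in> C \<longrightarrow> norm (g x) \<le> norm (1 + (g x)\<^sup>2)"
        by auto
    qed
  qed
  have int_gc: "set_integrable lborel C (\<lambda>y. complex_of_real (g y) * char m y)" for m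
    by (rule set_integrable_bound[OF int_g]) (auto simp: set_borel_measurable_def norm_mult)
  have T2: "(LINT y:C|lborel. (cmod (T y))\<^sup>2) \<le> c * X"
  proof -
    define M :: "(real^'d) set" where "M = lattice_box (Suc L)"
    have M: "finite M" "M \<subseteq> int_lattice"
      unfolding M_def by (rule finite_lattice_box lattice_box_subset)+
    \<comment> \<open>A majorant of \<bar>P\<bar>^2 on the image of \<open>C\<close> that is made of
      whole cells: by periodicity and Parseval each cell contributes exactly
      \<open>X\<close>.\<close>
    define H where "H x = (\<Sum>k\<in>M. indicator unit_cell (x - k) * (cmod (P x))\<^sup>2)" for x
    have int_cell: "integrable lborel (\<lambda>x. indicator unit_cell (x - k) * (cmod (P x))\<^sup>2)"
      and cell: "(LINT x|lborel. indicator unit_cell (x - k) * (cmod (P x))\<^sup>2) = X"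
      if "k \<in> int_lattice" for k
    proof -
      have per: "P (x + k) = P x" for x
        using A(2) that by (auto simp: P_def char_add_right char_lattice subset_iff intro!: sum.cong)
      have "set_integrable lborel unit_cell (\<lambda>x. (cmod (P x))\<^sup>2)"
        by (rule integrable_unit_cell[where K = "(\<Sum>m\<in>A. cmod (a m))\<^sup>2"]) (use P2_bdd in auto)
      then have *: "integrable lborel (\<lambda>x. indicator unit_cell x * (cmod (P (x + k)))\<^sup>2)"
        by (simp add: set_integrable_def per)
      from integrable_lborel_translate[OF *, of "- k"]
      show int: "integrable lborel (\<lambda>x. indicator unit_cell (x - k) * (cmod (P x))\<^sup>2)"
        by simp
      have "(LINT x|lborel. indicator unit_cell (x - k) * (cmod (P x))\<^sup>2)
          = (LINT x|lborel. indicator unit_cell x * (cmod (P (x + k)))\<^sup>2)"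
        using lborel_integral_translate[of "\<lambda>x. indicator unit_cell (x - k) * (cmod (P x))\<^sup>2" k]
          borel_measurable_integrable[OF int] by simp
      also have "\<dots> = (LINT x:unit_cell|lborel. (cmod (P x))\<^sup>2)"
        by (simp add: set_lebesgue_integral_def per)
      also have "\<dots> = X"
        using parseval_unit_cell[OF A, of "\<lambda>m. cnj (a m)"] by (simp add: P_def X_def)
      finally show "(LINT x|lborel. indicator unit_cell (x - k) * (cmod (P x))\<^sup>2) = X" .
    qed
    have int_H: "integrable lborel H"
      unfolding H_def[abs_def] using int_cell M(2) by (intro Bochner_Integration.integrable_sum) auto
    then have meas_H: "H \<in> borel_measurable borel"
      by (simp add: borel_measurable_integrable)
    have St: "invertible (transpose S)"
      using S by (simp add: invertible_det_nz det_transpose)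
    have H_S: "(LINT y|lborel. H (transpose S *v y)) = real (card M) * X / \<bar>det S\<bar>"
    proof -
      have "\<bar>det S\<bar> * (LINT y|lborel. H (transpose S *v y)) = (LINT x|lborel. H x)"
        using lborel_integral_linear[OF St meas_H] by simp
      also have "\<dots> = (\<Sum>k\<in>M. LINT x|lborel. indicator unit_cell (x - k) * (cmod (P x))\<^sup>2)"
        unfolding H_def using int_cell M(2) by (intro Bochner_Integration.integral_sum) auto
      also have "\<dots> = real (card M) * X"
        using cell M(2) by (simp add: subset_iff)
      finally show ?thesis
        using det by (simp add: field_simps)
    qed
    \<comment> \<open>The value of the integral alone would not give this, since nonintegrable
      functions also receive a value; integrability is transferred through the density form.\<close>
    have int_HS: "integrable lborel (\<lambda>y. H (transpose S *v y))"
    proof -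
      have "integrable (density (distr lborel borel ((*v) (transpose S))) (\<lambda>_. ennreal \<bar>det (transpose S)\<bar>)) H"
        using int_H lborel_linear[OF St] by simp
      then have "integrable (distr lborel borel ((*v) (transpose S))) (\<lambda>x. \<bar>det (transpose S)\<bar> *\<^sub>R H x)"
        using meas_H by (subst (asm) integrable_density) auto
      then have "integrable (distr lborel borel ((*v) (transpose S))) H"
        using det by simp
      then show ?thesis
        using lin meas_H by (subst (asm) integrable_distr_eq) auto
    qed
    have "(LINT y:C|lborel. (cmod (T y))\<^sup>2) \<le> (LINT y|lborel. H (transpose S *v y))"
      unfolding set_lebesgue_integral_def
    proof (rule integral_mono)
      show "integrable lborel (\<lambda>x. indicat_real C x *\<^sub>R (cmod (T x))\<^sup>2)"
        using int_T2 by (simp add: set_integrable_def)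
      show "indicat_real C y *\<^sub>R (cmod (T y))\<^sup>2 \<le> H (transpose S *v y)" for y
      proof (cases "y \<in> C")
        case True
        have "nearest (transpose S *v y) \<in> M"
          unfolding M_def by (intro nearest_in_lattice_box C_le True)
        then have "(\<Sum>k\<in>M. indicator unit_cell (transpose S *v y - k)) = (1::real)"
          by (rule sum_indicator_unit_cell[OF M])
        then show ?thesis
          using True by (simp add: H_def T_def flip: sum_distrib_right)
      next
        case False
        then show ?thesis
          by (auto simp: H_def intro!: sum_nonneg)
      qed
    qed (rule int_HS)
    also have "\<dots> \<le> c * X"
    proof -
      have "real (card M) \<le> real ((2 * Suc L + 1) ^ CARD('d))"
        unfolding M_def by (intro of_nat_mono card_lattice_box_le)
      also have "\<dots> = real (2 * L + 3) ^ CARD('d)"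
        by (simp add: eval_nat_numeral)
      finally have "real (card M) * (X / \<bar>det S\<bar>) \<le> real (2 * L + 3) ^ CARD('d) * (X / \<bar>det S\<bar>)"
        by (intro mult_right_mono) (auto simp: X_def sum_nonneg)
      then show ?thesis
        by (simp only: H_S c_def times_divide_eq_left times_divide_eq_right)
    qed
    finally show ?thesis .
  qed
  have "complex_of_real X = (\<Sum>m\<in>A. cnj (a m) * a m)"
    by (simp add: X_def complex_norm_square mult.commute flip: of_real_power)
  also have "\<dots> = (\<Sum>m\<in>A. LINT y:C|lborel. cnj (a m) * (complex_of_real (g y) * char (S *v m) y))"
    by (simp add: a_def)
  also have "\<dots> = (LINT y:C|lborel. (\<Sum>m\<in>A. cnj (a m) * (complex_of_real (g y) * char (S *v m) y)))"
    unfolding set_lebesgue_integral_def scaleR_sum_right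
    using set_integrable_mult_right[OF int_gc]
    by (intro Bochner_Integration.integral_sum[symmetric]) (auto simp: set_integrable_def)
  also have "\<dots> = (LINT y:C|lborel. complex_of_real (g y) * T y)"
    by (simp add: T_def P_def sum_distrib_left char_matrix mult.left_commute)
  finally have X_eq: "complex_of_real X = (LINT y:C|lborel. complex_of_real (g y) * T y)" .
  have "0 \<le> X"
    by (simp add: X_def sum_nonneg)
  then have "X = cmod (complex_of_real X)"
    by simp
  also have "\<dots> = cmod (LINT y:C|lborel. complex_of_real (g y) * T y)"
    by (simp only: X_eq)
  also have "\<dots> \<le> (LINT y:C|lborel. (c * (g y)\<^sup>2 + (cmod (T y))\<^sup>2 / c) / 2)"
  proof (rule set_integral_norm_le)
    have int_gT: "set_integrable lborel C (\<lambda>y. (\<Sum>m\<in>A. cmod (a m)) * g y)"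
      using int_g by (intro set_integrable_mult_right)
    show "set_integrable lborel C (\<lambda>y. complex_of_real (g y) * T y)"
    proof (rule set_integrable_bound[OF int_gT])
      show "set_borel_measurable lborel C (\<lambda>y. complex_of_real (g y) * T y)"
        unfolding set_borel_measurable_def by measurable
      have "\<bar>g y\<bar> * cmod (T y) \<le> \<bar>g y\<bar> * (\<Sum>m\<in>A. cmod (a m))" for y
        unfolding T_def by (intro mult_left_mono P_bdd) auto
      then show "AE y in lborel. y \<in> C \<longrightarrow>
          norm (complex_of_real (g y) * T y) \<le> norm ((\<Sum>m\<in>A. cmod (a m)) * g y)"
        by (simp add: norm_mult abs_mult mult.commute sum_nonneg)
    qed
    show "set_integrable lborel C (\<lambda>y. (c * (g y)\<^sup>2 + (cmod (T y))\<^sup>2 / c) / 2)"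
      using g2 int_T2 by (intro set_integrable_divide set_integral_add set_integrable_mult_right) auto
    \<comment> \<open>Young's inequality weighted by c takes the place of Cauchy-Schwarz. With
      \<open>T2\<close> it gives X \<le> (c G + X) / 2, which is solved for X without dividing by
      it.\<close>
    have amgm: "u * v \<le> (c * u\<^sup>2 + v\<^sup>2 / c) / 2" for u v :: real
    proof -
      have "0 \<le> (c * u - v)\<^sup>2 / c"
        using c by simp
      also have "\<dots> = c * u\<^sup>2 + v\<^sup>2 / c - 2 * (u * v)"
        using c by (simp add: power2_eq_square field_simps)
      finally show ?thesis by simp
    qed
    show "norm (complex_of_real (g y) * T y) \<le> (c * (g y)\<^sup>2 + (cmod (T y))\<^sup>2 / c) / 2" for y
      using amgm[of "\<bar>g y\<bar>" "cmod (T y)"] by (simp add: norm_mult)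
  qed
  also have "\<dots> = (c * G + (LINT y:C|lborel. (cmod (T y))\<^sup>2) / c) / 2"
    unfolding G_def using g2 int_T2 by simp
  also have "\<dots> \<le> (c * G + X) / 2"
    using T2 c by (simp add: divide_le_eq mult.commute)
  finally have "X \<le> c * G"
    by simp
  then show ?thesis
    by (simp add: X_def a_def c_def G_def)
qed

subsection \<open>A supply of test functions\<close>

text \<open>\<open>smooth\<close> speaks of all iterated partial derivatives at once, which is
  awkward for products and inverses. This class is closed under \<open>partial\<close>, so
  differentiability of its members already gives smoothness. The rule \<open>ridge\<close> carries a
  whole sequence of derivatives in order that differentiating stays within the class.\<close>

inductive smooth_alg :: "(real^'d \<Rightarrow> real) \<Rightarrow> bool" where
  ridge: "(\<And>n t. (D n has_real_derivative D (Suc n) t) (at t)) \<Longrightarrow> smooth_alg (\<lambda>x. D n (a \<bullet> x + b))"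
| add: "smooth_alg \<phi> \<Longrightarrow> smooth_alg \<psi> \<Longrightarrow> smooth_alg (\<lambda>x. \<phi> x + \<psi> x)"
| mult: "smooth_alg \<phi> \<Longrightarrow> smooth_alg \<psi> \<Longrightarrow> smooth_alg (\<lambda>x. \<phi> x * \<psi> x)"
| inverse: "smooth_alg \<phi> \<Longrightarrow> (\<And>x. \<phi> x \<noteq> 0) \<Longrightarrow> smooth_alg (\<lambda>x. inverse (\<phi> x))"

lemma smooth_alg_const: "smooth_alg (\<lambda>_. c)"
  using smooth_alg.ridge[of "\<lambda>n t. if n = 0 then c else 0" 0] by simp

lemma smooth_alg_prod: "(\<And>i. i \<in> I \<Longrightarrow> smooth_alg (\<phi> i)) \<Longrightarrow> smooth_alg (\<lambda>x. \<Prod>i\<in>I. \<phi> i x)"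
proof (induction I rule: infinite_finite_induct)
  case (insert i I)
  then show ?case
    using smooth_alg.mult[of "\<phi> i" "\<lambda>x. \<Prod>i\<in>I. \<phi> i x"] by simp
qed (use smooth_alg_const in simp_all)

lemma partial_eqI: "(\<And>x. (\<phi> has_derivative f' x) (at x)) \<Longrightarrow> partial j \<phi> = (\<lambda>x. f' x (axis j 1))"
  by (simp add: partial_def fun_eq_iff) (metis frechet_derivative_at)

lemma smooth_alg_partial:
  assumes "smooth_alg \<phi>"
  shows "(\<forall>x. \<phi> differentiable (at x)) \<and> smooth_alg (partial j \<phi>)"
  using assms
proof induction
  case (ridge D n a b)
  have *: "((\<lambda>x. D n (a \<bullet> x + b)) has_derivative (\<lambda>h. (a \<bullet> h) * D (Suc n) (a \<bullet> x + b))) (at x)" for x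
  proof -
    have "((\<lambda>x. a \<bullet> x + b) has_derivative (\<lambda>h. a \<bullet> h)) (at x)"
      by (auto intro!: derivative_eq_intros)
    from has_derivative_compose[OF this ridge[unfolded has_field_derivative_def, of n]]
    show ?thesis
      by (simp add: mult.commute)
  qed
  have "partial j (\<lambda>x. D n (a \<bullet> x + b)) = (\<lambda>x. (a $ j) * D (Suc n) (a \<bullet> x + b))"
    by (subst partial_eqI[OF *]) (simp add: inner_axis)
  then show ?case
    using * smooth_alg.mult[OF smooth_alg_const[of "a $ j"] smooth_alg.ridge[of D "Suc n" a b, OF ridge]]
    by (auto simp: differentiable_def)
next
  case (add \<phi> \<psi>)
  have *: "((\<lambda>x. \<phi> x + \<psi> x) has_derivative (\<lambda>h. frechet_derivative \<phi> (at x) h + frechet_derivative \<psi> (at x) h)) (at x)" for x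
    using add by (intro has_derivative_add) (auto simp: frechet_derivative_works)
  then have "partial j (\<lambda>x. \<phi> x + \<psi> x) = (\<lambda>x. partial j \<phi> x + partial j \<psi> x)"
    by (subst partial_eqI[OF *]) (simp add: partial_def)
  then show ?case
    using add.IH * by (auto simp: differentiable_def intro: smooth_alg.intros)
next
  case (mult \<phi> \<psi>)
  have *: "((\<lambda>x. \<phi> x * \<psi> x) has_derivative
      (\<lambda>h. \<phi> x * frechet_derivative \<psi> (at x) h + frechet_derivative \<phi> (at x) h * \<psi> x)) (at x)" for x
    using mult by (intro has_derivative_mult) (auto simp: frechet_derivative_works)
  then have "partial j (\<lambda>x. \<phi> x * \<psi> x) = (\<lambda>x. \<phi> x * partial j \<psi> x + partial j \<phi> x * \<psi> x)"
    by (subst partial_eqI[OF *]) (simp add: partial_def)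
  then show ?case
    using mult * by (auto simp: differentiable_def intro: smooth_alg.intros)
next
  case (inverse \<phi>)
  have *: "((\<lambda>x. inverse (\<phi> x)) has_derivative
      (\<lambda>h. - (inverse (\<phi> x) * frechet_derivative \<phi> (at x) h * inverse (\<phi> x)))) (at x)" for x
    using inverse by (intro Deriv.has_derivative_inverse) (auto simp: frechet_derivative_works)
  then have eq: "partial j (\<lambda>x. inverse (\<phi> x)) =
      (\<lambda>x. -1 * (inverse (\<phi> x) * partial j \<phi> x * inverse (\<phi> x)))"
    by (subst partial_eqI[OF *]) (simp add: partial_def)
  have "smooth_alg (\<lambda>x. -1 * (inverse (\<phi> x) * partial j \<phi> x * inverse (\<phi> x)))"
    using inverse by (intro smooth_alg.mult smooth_alg_const smooth_alg.inverse) auto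
  then show ?case
    using * unfolding eq by (auto simp: differentiable_def)
qed

lemma smooth_alg_imp_smooth:
  assumes "smooth_alg \<phi>"
  shows "smooth \<phi>"
proof -
  have "smooth_alg (foldr partial js \<phi>)" for js
    using assms by (induction js) (auto simp: smooth_alg_partial)
  then show ?thesis
    using smooth_alg_partial by (auto simp: smooth_def differentiable_on_def intro: differentiable_at_withinI)
qed

section \<open>The flat function exp(-1/t) and the smooth step\<close>

lemma poly_div_exp_tendsto_0: "((\<lambda>y. poly p y / exp y) \<longlongrightarrow> (0::real)) at_top"
proof -
  have "((\<lambda>y. \<Sum>i\<le>degree p. coeff p i * (y ^ i / exp y)) \<longlongrightarrow> (\<Sum>i\<le>degree p. coeff p i * 0)) at_top"
    by (intro tendsto_sum tendsto_mult tendsto_const tendsto_power_div_exp_0)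
  then show ?thesis
    by (simp add: poly_altdef sum_divide_distrib)
qed

text \<open>The polynomial factor in 1/t makes the family closed under differentiation;
  \<open>flat 1\<close> is the classical smooth function that vanishes on the negative
  half-line.\<close>

definition flat :: "real poly \<Rightarrow> real \<Rightarrow> real" where
  "flat p t = (if t \<le> 0 then 0 else poly p (1 / t) * exp (- (1 / t)))"

text \<open>With y = 1/t, the derivative of p(y) exp(-y) in t is y^2 (p(y) - p'(y)) exp(-y).\<close>

definition flat_step :: "real poly \<Rightarrow> real poly" where
  "flat_step p = [:0, 0, 1:] * (p - pderiv p)"

lemma flat_has_derivative: "(flat p has_real_derivative flat (flat_step p) t) (at t)"
proof -
  consider "t < 0" | "t > 0" | "t = 0" by linarith
  then show ?thesis
  proof cases
    case 1
    have "((\<lambda>_. 0) has_real_derivative 0) (at t)"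
      by simp
    then have "(flat p has_real_derivative 0) (at t)"
      by (rule has_field_derivative_transform_within_open[where S = "{..<0}"]) (use 1 in \<open>auto simp: flat_def\<close>)
    then show ?thesis
      using 1 by (simp add: flat_def)
  next
    case 2
    have "((\<lambda>t. poly p (1 / t) * exp (- (1 / t))) has_real_derivative
        poly (flat_step p) (1 / t) * exp (- (1 / t))) (at t)"
      using 2 by (auto intro!: derivative_eq_intros simp: flat_step_def field_simps power2_eq_square)
    then have "(flat p has_real_derivative poly (flat_step p) (1 / t) * exp (- (1 / t))) (at t)"
      by (rule has_field_derivative_transform_within_open[where S = "{0<..}"]) (use 2 in \<open>auto simp: flat_def\<close>)
    then show ?thesis
      using 2 by (simp add: flat_def)
  next
    case 3
    have "((\<lambda>h. (flat p (0 + h) - flat p 0) / h) \<longlongrightarrow> 0) (at 0)"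
    proof (rule filterlim_split_at)
      have "eventually (\<lambda>h. 0 = (flat p (0 + h) - flat p 0) / h) (at_left 0)"
        by (auto simp: flat_def eventually_at_left_field intro!: exI[of _ "-1"])
      then show "((\<lambda>h. (flat p (0 + h) - flat p 0) / h) \<longlongrightarrow> 0) (at_left 0)"
        by (rule Lim_transform_eventually[OF tendsto_const])
      \<comment> \<open>With y = 1/h the difference quotient at 0 is y p(y) / exp(y); the division
        by h accounts for the extra factor y, that is, for \<open>pCons 0 p\<close>.\<close>
      have "((\<lambda>h. poly (pCons 0 p) (inverse h) / exp (inverse h)) \<longlongrightarrow> 0) (at_right 0)"
        by (rule filterlim_compose[OF poly_div_exp_tendsto_0 filterlim_inverse_at_top_right])
      moreover have "eventually (\<lambda>h. poly (pCons 0 p) (inverse h) / exp (inverse h) = (flat p (0 + h) - flat p 0) / h) (at_right 0)"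
        by (auto simp: flat_def eventually_at_right_field exp_minus field_simps intro!: exI[of _ 1])
      ultimately show "((\<lambda>h. (flat p (0 + h) - flat p 0) / h) \<longlongrightarrow> 0) (at_right 0)"
        by (rule Lim_transform_eventually)
    qed
    then show ?thesis
      using 3 by (simp add: DERIV_def flat_def)
  qed
qed

lemma smooth_alg_flat: "smooth_alg (\<lambda>x. flat p (a \<bullet> x + b))"
  using smooth_alg.ridge[of "\<lambda>n. flat ((flat_step ^^ n) p)" 0 a b] flat_has_derivative by simp

text \<open>The denominator is positive everywhere because t and 1 - t are never both
  nonpositive.\<close>

definition sstep :: "real \<Rightarrow> real" where
  "sstep t = flat 1 t / (flat 1 t + flat 1 (1 - t))"

lemma flat_1_nonneg: "0 \<le> flat 1 t"
  by (simp add: flat_def)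

lemma flat_1_pos: "0 < flat 1 t + flat 1 (1 - t)"
  by (auto simp: flat_def add_pos_pos)

lemma sstep_0: "t \<le> 0 \<Longrightarrow> sstep t = 0"
  and sstep_1: "1 \<le> t \<Longrightarrow> sstep t = 1"
  by (auto simp: sstep_def flat_def)

lemma sstep_nonneg: "0 \<le> sstep t"
  using flat_1_nonneg flat_1_pos[of t] by (simp add: sstep_def)

lemma sstep_le_1: "sstep t \<le> 1"
  using flat_1_nonneg[of "1 - t"] flat_1_pos[of t] by (simp add: sstep_def divide_le_eq)

lemma smooth_alg_sstep: "smooth_alg (\<lambda>x. sstep (a \<bullet> x + b))"
proof -
  have "smooth_alg (\<lambda>x. flat 1 (1 - (a \<bullet> x + b)))"
    using smooth_alg_flat[of 1 "- a" "1 - b"] by (simp add: algebra_simps)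
  then have "smooth_alg (\<lambda>x. flat 1 (a \<bullet> x + b) * inverse (flat 1 (a \<bullet> x + b) + flat 1 (1 - (a \<bullet> x + b))))"
    using flat_1_pos by (intro smooth_alg.mult smooth_alg.inverse smooth_alg.add smooth_alg_flat) (auto simp: less_imp_neq[symmetric])
  then show ?thesis
    by (simp add: sstep_def divide_inverse)
qed

text \<open>For k > 0 the arguments of \<open>sstep\<close> reach 1 at the faces of the unit cube
  and fall to 0 at distance 1/k outside them. So the cutoff is 1 on the closed cube, and its support
  shrinks to the cube as k grows.\<close>

definition cutoff :: "real \<Rightarrow> real^'d \<Rightarrow> real" where
  "cutoff k x = (\<Prod>j\<in>UNIV. sstep (1 + k * x $ j) * sstep (1 + k * (1 - x $ j)))"

lemma smooth_alg_cutoff: "smooth_alg (cutoff k)"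
proof -
  have "smooth_alg (\<lambda>x. sstep (1 + k * x $ j))" for j :: 'a
    using smooth_alg_sstep[of "k *\<^sub>R axis j 1" 1] by (simp add: inner_axis' add.commute)
  moreover have "smooth_alg (\<lambda>x. sstep (1 + k * (1 - x $ j)))" for j :: 'a
    using smooth_alg_sstep[of "- k *\<^sub>R axis j 1" "1 + k"] by (simp add: inner_axis' algebra_simps)
  ultimately show ?thesis
    unfolding cutoff_def[abs_def] by (intro smooth_alg_prod smooth_alg.mult) auto
qed

lemma cutoff_nonneg: "0 \<le> cutoff k x"
  by (auto simp: cutoff_def sstep_nonneg intro!: prod_nonneg)

lemma cutoff_le_1: "cutoff k x \<le> 1"
  unfolding cutoff_def by (intro prod_le_1) (auto simp: sstep_nonneg sstep_le_1 mult_le_one)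

lemma cutoff_eq_1: "x \<in> cbox 0 1 \<Longrightarrow> 0 \<le> k \<Longrightarrow> cutoff k x = 1"
  by (auto simp: cutoff_def mem_box_cart sstep_1)

lemma cutoff_nonzeroD:
  assumes "cutoff k x \<noteq> 0"
  shows "0 < 1 + k * x $ j" "0 < 1 + k * (1 - x $ j)"
proof -
  have "sstep (1 + k * x $ j) \<noteq> 0 \<and> sstep (1 + k * (1 - x $ j)) \<noteq> 0"
    using assms by (auto simp: cutoff_def)
  then show "0 < 1 + k * x $ j" "0 < 1 + k * (1 - x $ j)"
    using sstep_0 by (meson linorder_not_less)+
qed

lemma cutoff_support:
  assumes "cutoff k x \<noteq> 0" "1 \<le> k"
  shows "x \<in> cbox (\<chi> j. -1) (\<chi> j. 2)"
proof -
  have "-1 \<le> x $ j \<and> x $ j \<le> 2" for j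
  proof -
    note * = cutoff_nonzeroD[OF assms(1), of j]
    have "x $ j \<ge> -1"
    proof (rule ccontr)
      assume "\<not> x $ j \<ge> -1"
      then have "k * x $ j \<le> k * -1"
        using assms(2) by (intro mult_left_mono) auto
      with * assms(2) show False by simp
    qed
    moreover have "1 - x $ j \<ge> -1"
    proof (rule ccontr)
      assume "\<not> 1 - x $ j \<ge> -1"
      then have "k * (1 - x $ j) \<le> k * -1"
        using assms(2) by (intro mult_left_mono) auto
      with * assms(2) show False by simp
    qed
    ultimately show ?thesis by simp
  qed
  then show ?thesis
    by (simp add: mem_box_cart)
qed

lemma cutoff_tendsto: "(\<lambda>n. cutoff (real (Suc n)) x) \<longlonglongrightarrow> indicator (cbox 0 1) x"
proof (cases "x \<in> cbox 0 1")
  case True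
  then show ?thesis
    by (simp add: cutoff_eq_1)
next
  case False
  then obtain j where "x $ j < 0 \<or> x $ j > 1"
    by (auto simp: mem_box_cart not_le)
  \<comment> \<open>Whichever of \<open>x $ j\<close> and \<open>1 - x $ j\<close> is negative; this
    treats opposite faces together. The cutoff vanishes once n + 1 is at least 1 / -y.\<close>
  then obtain y where y: "y < 0" "y = x $ j \<or> y = 1 - x $ j"
    by (metis diff_gt_0_iff_gt less_diff_eq add_0 diff_less_0_iff_less)
  have "eventually (\<lambda>n. cutoff (real (Suc n)) x = 0) sequentially"
  proof -
    obtain N :: nat where N: "1 / - y \<le> real N"
      using real_arch_simple by blast
    have "cutoff (real (Suc n)) x = 0" if "n \<ge> N" for n
    proof (rule ccontr)
      assume "cutoff (real (Suc n)) x \<noteq> 0"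
      then have *: "0 < 1 + real (Suc n) * y"
        using cutoff_nonzeroD y(2) by blast
      have "1 / - y \<le> real (Suc n)"
        using N that by linarith
      then have "1 \<le> real (Suc n) * - y"
        using y(1) by (simp add: field_simps)
      with * show False by simp
    qed
    then show ?thesis
      unfolding eventually_sequentially by blast
  qed
  then show ?thesis
    using False by (simp add: tendsto_eventually)
qed

section \<open>Iterated derivatives of plane waves and pure multi-indices\<close>

lemma smooth_alg_cos: "smooth_alg (\<lambda>x. cos (\<xi> \<bullet> x + t))"
proof -
  have "((\<lambda>y. cos (y + real n * pi / 2)) has_real_derivative cos (y + real (Suc n) * pi / 2)) (at y)" for n y
  proof -
    have "cos (y + real (Suc n) * pi / 2) = - sin (y + real n * pi / 2)"
      using minus_sin_cos_eq[of "y + real n * pi / 2"] by (simp add: field_simps)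
    then show ?thesis
      by (auto intro!: derivative_eq_intros)
  qed
  then show ?thesis
    using smooth_alg.ridge[of "\<lambda>n y. cos (y + real n * pi / 2)" 0 \<xi> t] by simp
qed

text \<open>Writing the derivative as a phase shift by pi/2 gives one formula for all orders, with
  no alternation between sine and cosine.\<close>

lemma partial_cos:
  "partial j (\<lambda>x. c * cos (\<xi> \<bullet> x + t)) = (\<lambda>x. c * \<xi> $ j * cos (\<xi> \<bullet> x + t + pi / 2))"
proof -
  have "((\<lambda>x. c * cos (\<xi> \<bullet> x + t)) has_derivative (\<lambda>h. c * (- sin (\<xi> \<bullet> x + t) * (\<xi> \<bullet> h)))) (at x)" for x
    by (auto intro!: derivative_eq_intros)
  from partial_eqI[OF this] show ?thesis
    by (simp add: inner_axis minus_sin_cos_eq mult_ac)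
qed

lemma foldr_partial_cos:
  "foldr partial (replicate s j) (\<lambda>x. cos (\<xi> \<bullet> x + t))
    = (\<lambda>x. \<xi> $ j ^ s * cos (\<xi> \<bullet> x + t + real s * pi / 2))"
proof (induction s)
  case (Suc s)
  have "foldr partial (replicate (Suc s) j) (\<lambda>x. cos (\<xi> \<bullet> x + t))
      = partial j (\<lambda>x. \<xi> $ j ^ s * cos (\<xi> \<bullet> x + (t + real s * pi / 2)))"
    by (simp only: replicate_Suc foldr.simps o_apply Suc.IH add.assoc)
  also have "\<dots> = (\<lambda>x. \<xi> $ j ^ Suc s * cos (\<xi> \<bullet> x + t + real (Suc s) * pi / 2))"
  proof -
    have "\<xi> \<bullet> x + (t + real s * pi / 2) + pi / 2 = \<xi> \<bullet> x + t + real (Suc s) * pi / 2" for x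
      by (simp add: add_divide_distrib distrib_right)
    then show ?thesis
      unfolding partial_cos by (simp only: power_Suc2)
  qed
  finally show ?case .
qed simp

text \<open>Differentiation is local, so a cutoff may be dropped on an open set where it equals 1.
  The point stays arbitrary in the induction, as the outer derivative needs the inner functions to
  agree on all of \<open>U\<close>.\<close>

lemma foldr_partial_cong_open:
  assumes U: "open U" and eq: "\<And>x. x \<in> U \<Longrightarrow> \<phi> x = \<psi> x" and "x \<in> U"
  shows "foldr partial js \<phi> x = foldr partial js \<psi> x"
  using \<open>x \<in> U\<close>
proof (induction js arbitrary: x)
  case (Cons j js)
  \<comment> \<open>No differentiability is assumed: \<open>frechet_derivative\<close> is a choice
    among the derivatives, so it is enough that both functions have the same ones.\<close>
  have "(foldr partial js \<phi> has_derivative F) (at x) \<longleftrightarrow> (foldr partial js \<psi> has_derivative F) (at x)" for F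
  proof
    assume "(foldr partial js \<phi> has_derivative F) (at x)"
    then show "(foldr partial js \<psi> has_derivative F) (at x)"
      by (rule has_derivative_transform_within_open[OF _ U Cons.prems]) (rule Cons.IH)
  next
    assume "(foldr partial js \<psi> has_derivative F) (at x)"
    then show "(foldr partial js \<phi> has_derivative F) (at x)"
      by (rule has_derivative_transform_within_open[OF _ U Cons.prems]) (rule Cons.IH[symmetric])
  qed
  then have "frechet_derivative (foldr partial js \<phi>) (at x) = frechet_derivative (foldr partial js \<psi>) (at x)"
    unfolding frechet_derivative_def by simp
  then show ?case
    unfolding foldr.simps o_apply partial_def by simp
qed (simp add: eq)

text \<open>A list in which only \<open>j\<close> occurs is determined by its length, so for pure
  derivatives the choice inside \<open>multi_partial\<close> is forced.\<close>

lemma multi_partial_axis: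
  "multi_partial (\<chi> i. if i = j then s else 0) \<phi> = foldr partial (replicate s j) \<phi>"
proof -
  define js where "js = (SOME js. \<forall>i. count_list js i = (\<chi> i. if i = j then s else 0) $ i)"
  have c: "\<forall>i. count_list js i = (\<chi> i. if i = j then s else 0) $ i"
    unfolding js_def by (rule someI_ex[OF multi_index_list_exists])
  have all: "i = j" if "i \<in> set js" for i
    using c[rule_format, of i] that by (auto simp: count_list_0_iff split: if_splits)
  then have "js = replicate (length js) j"
    by (simp add: replicate_eqI)
  moreover have "count_list xs j = length xs" if "\<And>i. i \<in> set xs \<Longrightarrow> i = j" for xs
    using that by (induction xs) auto
  then have "length js = s"
    using c[rule_format, of j] all by simp
  ultimately show ?thesis
    by (simp add: multi_partial_def js_def)
qed

lemma multi_order_axis: "multi_order (\<chi> i. if i = j then s else 0) = s"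
  by (simp add: multi_order_def)

subsection \<open>Fourier transforms of weak derivatives\<close>

text \<open>The nonzero set of a continuous function is open and hence lies in the interior of the
  cube. This gives each of its points a neighbourhood on which every cutoff equals 1.\<close>

lemma support_in_open_cube:
  fixes f :: "real^'d \<Rightarrow> real"
  assumes "continuous_on UNIV f" "closure {x. f x \<noteq> 0} \<subseteq> cbox 0 1" "f x \<noteq> 0"
  shows "x \<in> box 0 1"
proof -
  have "open {x. f x \<noteq> 0}"
    by (rule open_Collect_neq[OF assms(1) continuous_on_const])
  moreover have "{x. f x \<noteq> 0} \<subseteq> cbox 0 1"
    by (rule order_trans[OF closure_subset assms(2)])
  ultimately have "{x. f x \<noteq> 0} \<subseteq> interior (cbox 0 1)"
    by (rule interior_maximal[rotated])
  with assms(3) show ?thesis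
    by auto
qed

lemma test_function_cutoff_cos:
  assumes "1 \<le> k"
  shows "test_function (\<lambda>x. cutoff k x * cos (\<xi> \<bullet> x + t))"
proof -
  have "{x. cutoff k x * cos (\<xi> \<bullet> x + t) \<noteq> 0} \<subseteq> cbox (\<chi> j. -1) (\<chi> j. 2)"
    using cutoff_support[OF _ assms] by auto
  then have "bounded {x. cutoff k x * cos (\<xi> \<bullet> x + t) \<noteq> 0}"
    by (rule bounded_subset[OF bounded_cbox])
  then show ?thesis
    unfolding test_function_def
    by (auto intro!: smooth_alg_imp_smooth smooth_alg.mult smooth_alg_cutoff smooth_alg_cos
        simp: compact_closure)
qed

text \<open>Testing against \<open>cos\<close> times cutoffs that equal 1 on the cube and shrink to its indicator,
  so that the values of \<open>g\<close> outside the cube do not matter.\<close>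

lemma weak_deriv_axis_cos:
  fixes f :: "real^'d \<Rightarrow> real"
  assumes cont: "continuous_on UNIV f" and supp: "closure {x. f x \<noteq> 0} \<subseteq> cbox 0 1"
    and weak: "is_weak_deriv (\<chi> i. if i = j then s else 0) f g"
  shows "\<xi> $ j ^ s * (LINT x|lborel. f x * cos (\<xi> \<bullet> x + t + real s * pi / 2))
    = (-1) ^ s * (LINT x:cbox 0 1|lborel. g x * cos (\<xi> \<bullet> x + t))"
proof -
  define \<phi> where "\<phi> n x = cutoff (real (Suc n)) x * cos (\<xi> \<bullet> x + t)" for n :: nat and x
  let ?Q = "cbox (\<chi> j. -1) (\<chi> j. 2) :: (real^'d) set"
  have test: "test_function (\<phi> n)" for n
    unfolding \<phi>_def[abs_def] by (rule test_function_cutoff_cos) simp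
  \<comment> \<open>Wherever f is nonzero the cutoff is locally 1, so the left-hand side of the weak
    derivative identity does not depend on n.\<close>
  have deriv: "f x * multi_partial (\<chi> i. if i = j then s else 0) (\<phi> n) x
      = f x * (\<xi> $ j ^ s * cos (\<xi> \<bullet> x + t + real s * pi / 2))" for n x
  proof (cases "f x = 0")
    case False
    then have x: "x \<in> box 0 1"
      by (rule support_in_open_cube[OF cont supp])
    have "foldr partial (replicate s j) (\<phi> n) x = foldr partial (replicate s j) (\<lambda>x. cos (\<xi> \<bullet> x + t)) x"
      by (rule foldr_partial_cong_open[OF open_box _ x])
        (use box_subset_cbox in \<open>force simp: \<phi>_def cutoff_eq_1\<close>)
    then show ?thesis
      by (simp only: multi_partial_axis foldr_partial_cos)
  qed simp
  have "(LINT x|lborel. f x * multi_partial (\<chi> i. if i = j then s else 0) (\<phi> n) x)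
      = (-1) ^ s * (LINT x|lborel. g x * \<phi> n x)" for n
    using weak test[of n] by (simp add: is_weak_deriv_def multi_order_axis)
  then have eq: "\<xi> $ j ^ s * (LINT x|lborel. f x * cos (\<xi> \<bullet> x + t + real s * pi / 2))
      = (-1) ^ s * (LINT x|lborel. g x * \<phi> n x)" for n
    by (simp only: deriv mult.left_commute[of "f _"] integral_mult_right_zero)
  have g_Q: "set_integrable lborel ?Q g"
    using weak by (simp add: is_weak_deriv_def locally_integrable_def)
  have smooth_cont: "\<phi> n \<in> borel_measurable borel" for n
  proof -
    have "foldr partial [] (\<phi> n) differentiable_on UNIV"
      using test[of n] unfolding test_function_def smooth_def by blast
    then show ?thesis
      by (intro borel_measurable_continuous_onI differentiable_imp_continuous_on) simp
  qed
  \<comment> \<open>All cutoffs live in one compact box, on which local integrability of g supplies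
    a majorant independent of n.\<close>
  have ind_Q: "g x * \<phi> n x = (indicator ?Q x *\<^sub>R g x) * \<phi> n x" for n x
    using cutoff_support[of "real (Suc n)" x] by (cases "x \<in> ?Q") (auto simp: \<phi>_def)
  have "(\<lambda>n. LINT x|lborel. (indicator ?Q x *\<^sub>R g x) * \<phi> n x)
      \<longlonglongrightarrow> (LINT x|lborel. (indicator ?Q x *\<^sub>R g x) * (indicator (cbox 0 1) x * cos (\<xi> \<bullet> x + t)))"
  proof (rule integral_dominated_convergence[where w = "\<lambda>x. \<bar>indicator ?Q x *\<^sub>R g x\<bar>"])
    have meas_g: "(\<lambda>x. indicator ?Q x *\<^sub>R g x) \<in> borel_measurable lborel"
      using g_Q unfolding set_integrable_def by (rule borel_measurable_integrable)
    show "(\<lambda>x. (indicator ?Q x *\<^sub>R g x) * \<phi> n x) \<in> borel_measurable lborel" for n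
      by (intro borel_measurable_times meas_g) (use smooth_cont in simp)
    have "(\<lambda>x. cos (\<xi> \<bullet> x + t)) \<in> borel_measurable borel"
      by (intro borel_measurable_continuous_onI continuous_intros)
    then show "(\<lambda>x. (indicator ?Q x *\<^sub>R g x) * (indicator (cbox 0 1) x * cos (\<xi> \<bullet> x + t))) \<in> borel_measurable lborel"
      by (intro borel_measurable_times meas_g) auto
    show "integrable lborel (\<lambda>x. \<bar>indicator ?Q x *\<^sub>R g x\<bar>)"
      using g_Q unfolding set_integrable_def by (rule integrable_abs)
    show "AE x in lborel. (\<lambda>n. (indicator ?Q x *\<^sub>R g x) * \<phi> n x)
        \<longlonglongrightarrow> (indicator ?Q x *\<^sub>R g x) * (indicator (cbox 0 1) x * cos (\<xi> \<bullet> x + t))"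
      unfolding \<phi>_def by (intro AE_I2 tendsto_intros cutoff_tendsto)
    show "AE x in lborel. norm ((indicator ?Q x *\<^sub>R g x) * \<phi> n x) \<le> \<bar>indicator ?Q x *\<^sub>R g x\<bar>" for n
    proof (rule AE_I2)
      fix x
      have "\<bar>\<phi> n x\<bar> \<le> 1 * 1"
        unfolding \<phi>_def abs_mult
        by (rule mult_mono) (auto simp: abs_of_nonneg[OF cutoff_nonneg] cutoff_le_1)
      then have "\<bar>indicator ?Q x *\<^sub>R g x\<bar> * \<bar>\<phi> n x\<bar> \<le> \<bar>indicator ?Q x *\<^sub>R g x\<bar>"
        by (intro mult_left_le) auto
      then show "norm ((indicator ?Q x *\<^sub>R g x) * \<phi> n x) \<le> \<bar>indicator ?Q x *\<^sub>R g x\<bar>"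
        unfolding real_norm_def abs_mult[of "indicator ?Q x *\<^sub>R g x"] .
    qed
  qed
  moreover have "(indicator ?Q x *\<^sub>R g x) * (indicator (cbox 0 1) x * cos (\<xi> \<bullet> x + t))
      = indicator (cbox 0 1) x *\<^sub>R (g x * cos (\<xi> \<bullet> x + t))" for x
  proof (cases "x \<in> cbox 0 1")
    case True
    then have "-1 \<le> x $ i \<and> x $ i \<le> 2" for i
      by (auto simp: mem_box_cart intro: order_trans[of "-1" 0] order_trans[of _ 1])
    then have "x \<in> ?Q"
      by (simp add: mem_box_cart)
    with True show ?thesis by simp
  qed simp
  ultimately have "(\<lambda>n. LINT x|lborel. g x * \<phi> n x) \<longlonglongrightarrow> (LINT x:cbox 0 1|lborel. g x * cos (\<xi> \<bullet> x + t))"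
    by (simp only: ind_Q set_lebesgue_integral_def)
  then have "(\<lambda>n. (-1) ^ s * (LINT x|lborel. g x * \<phi> n x))
      \<longlonglongrightarrow> (-1) ^ s * (LINT x:cbox 0 1|lborel. g x * cos (\<xi> \<bullet> x + t))"
    by (rule tendsto_mult_left)
  then show ?thesis
    unfolding eq[symmetric] by (simp add: tendsto_const_iff LIMSEQ_const_iff)
qed

text \<open>Test functions are real, so the phases t = 0 and t = -pi/2 in
  \<open>weak_deriv_axis_cos\<close> supply the real and the imaginary part. The factors
  \<open>cis (s * pi / 2)\<close> and \<open>(-1) ^ s\<close> have modulus 1.\<close>

lemma norm_fourier_weak_deriv_axis:
  fixes f :: "real^'d \<Rightarrow> real"
  assumes cont: "continuous_on UNIV f" and supp: "closure {x. f x \<noteq> 0} \<subseteq> cbox 0 1"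
    and weak: "is_weak_deriv (\<chi> i. if i = j then s else 0) f g"
  shows "\<bar>\<xi> $ j\<bar> ^ s * cmod (LINT x|lborel. complex_of_real (f x) * cis (\<xi> \<bullet> x))
    = cmod (LINT x:cbox 0 1|lborel. complex_of_real (g x) * cis (\<xi> \<bullet> x))"
proof -
  let ?F = "LINT x|lborel. complex_of_real (f x) * cis (\<xi> \<bullet> x + real s * pi / 2)"
  let ?G = "LINT x:cbox 0 1|lborel. complex_of_real (g x) * cis (\<xi> \<bullet> x)"
  have cis_cont: "continuous_on UNIV (\<lambda>x. cis (\<xi> \<bullet> x + r))" for r
    unfolding cis_conv_exp by (intro continuous_intros)
  have "integrable lborel (\<lambda>x. indicator (cbox 0 1) x *\<^sub>R (complex_of_real (f x) * cis (\<xi> \<bullet> x + real s * pi / 2)))"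
    by (intro borel_integrable_compact continuous_intros compact_cbox)
      (auto intro: continuous_on_subset[OF cont] continuous_on_subset[OF cis_cont])
  moreover have "indicator (cbox 0 1) x *\<^sub>R (complex_of_real (f x) * cis (\<xi> \<bullet> x + real s * pi / 2))
      = complex_of_real (f x) * cis (\<xi> \<bullet> x + real s * pi / 2)" for x
    using support_in_open_cube[OF cont supp, of x] box_subset_cbox by (cases "f x = 0") (auto simp: indicator_def)
  ultimately have int_f: "integrable lborel (\<lambda>x. complex_of_real (f x) * cis (\<xi> \<bullet> x + real s * pi / 2))"
    by simp
  have "set_integrable lborel (cbox 0 1) g"
    using weak by (simp add: is_weak_deriv_def locally_integrable_def)
  then have int_g: "integrable lborel (\<lambda>x. indicator (cbox 0 1) x *\<^sub>R (complex_of_real (g x) * cis (\<xi> \<bullet> x)))"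
    unfolding set_integrable_def
  proof (rule Bochner_Integration.integrable_bound)
    have "(\<lambda>x. indicator (cbox 0 1) x *\<^sub>R g x) \<in> borel_measurable lborel"
      using \<open>set_integrable lborel (cbox 0 1) g\<close> unfolding set_integrable_def by (rule borel_measurable_integrable)
    then have m: "(\<lambda>x. complex_of_real (indicator (cbox 0 1) x *\<^sub>R g x)) \<in> borel_measurable lborel"
      by measurable
    have c: "(\<lambda>x. cis (\<xi> \<bullet> x)) \<in> borel_measurable lborel"
      using borel_measurable_continuous_onI[OF cis_cont[of 0]] by simp
    show "(\<lambda>x. indicator (cbox 0 1) x *\<^sub>R (complex_of_real (g x) * cis (\<xi> \<bullet> x))) \<in> borel_measurable lborel"
      using borel_measurable_times[OF m c] by (simp add: scaleR_conv_of_real mult.assoc)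
  qed (simp add: norm_mult)
  have "of_real (\<xi> $ j ^ s) * ?F = of_real ((-1) ^ s) * ?G"
  proof (rule complex_eqI)
    have "\<xi> $ j ^ s * Re ?F = \<xi> $ j ^ s * (LINT x|lborel. f x * cos (\<xi> \<bullet> x + 0 + real s * pi / 2))"
      by (simp add: integral_Re[OF int_f, symmetric])
    also have "\<dots> = (-1) ^ s * (LINT x:cbox 0 1|lborel. g x * cos (\<xi> \<bullet> x + 0))"
      by (rule weak_deriv_axis_cos[OF cont supp weak])
    also have "\<dots> = (-1) ^ s * Re ?G"
      by (simp add: set_lebesgue_integral_def integral_Re[OF int_g, symmetric])
    finally show "Re (of_real (\<xi> $ j ^ s) * ?F) = Re (of_real ((-1) ^ s) * ?G)"
      by (simp only: Re_complex_of_real Im_complex_of_real times_complex.sel mult_zero_left diff_zero)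
    have "sin y = cos (y - pi / 2)" for y :: real
      by (simp add: cos_diff)
    then have sin_f: "sin (\<xi> \<bullet> x + real s * pi / 2) = cos (\<xi> \<bullet> x + - (pi / 2) + real s * pi / 2)"
      and sin_g: "sin (\<xi> \<bullet> x) = cos (\<xi> \<bullet> x + - (pi / 2))" for x
      by (simp_all add: algebra_simps)
    have "\<xi> $ j ^ s * Im ?F = \<xi> $ j ^ s * (LINT x|lborel. f x * cos (\<xi> \<bullet> x + - (pi / 2) + real s * pi / 2))"
      by (simp only: integral_Im[OF int_f, symmetric] Im_complex_of_real Re_complex_of_real
          times_complex.sel cis.sel sin_f mult_zero_left add_0_right)
    also have "\<dots> = (-1) ^ s * (LINT x:cbox 0 1|lborel. g x * cos (\<xi> \<bullet> x + - (pi / 2)))"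
      by (rule weak_deriv_axis_cos[OF cont supp weak])
    also have "\<dots> = (-1) ^ s * Im ?G"
      by (simp only: set_lebesgue_integral_def integral_Im[OF int_g, symmetric] Im_complex_of_real
          Re_complex_of_real times_complex.sel cis.sel sin_g mult_zero_left add_0_right scaleR_complex.sel
          real_scaleR_def)
    finally show "Im (of_real (\<xi> $ j ^ s) * ?F) = Im (of_real ((-1) ^ s) * ?G)"
      by (simp only: Re_complex_of_real Im_complex_of_real times_complex.sel mult_zero_left add_0_right)
  qed
  then have "\<bar>\<xi> $ j\<bar> ^ s * cmod ?F = cmod ?G"
    by (metis (no_types, lifting) norm_mult norm_of_real power_abs abs_minus_cancel abs_1 abs_neg_one power_one mult_1)
  moreover have "?F = cis (real s * pi / 2) * (LINT x|lborel. complex_of_real (f x) * cis (\<xi> \<bullet> x))"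
  proof -
    have "cis (\<xi> \<bullet> x + real s * pi / 2) = cis (real s * pi / 2) * cis (\<xi> \<bullet> x)" for x
      by (simp add: cis_mult add.commute)
    then show ?thesis
      by (simp only: mult.left_commute[of "complex_of_real _"] integral_mult_right_zero)
  qed
  ultimately show ?thesis
    by (simp add: norm_mult)
qed

subsection \<open>Sums over the lattice points\<close>

lemma matrix_vector_inj_on_lattice:
  fixes B :: "real^'d^'d"
  assumes "frolov_matrix B"
  shows "inj_on ((*v) B) A"
proof -
  have "invertible B"
    using assms by (simp add: frolov_matrix_def)
  then have "inj ((*v) B)"
    by (simp add: inj_matrix_vector_mult)
  then show ?thesis
    using inj_on_subset by blast
qed

text \<open>If all coordinates were below 1 in absolute value, so would be their product. This lets
  the dyadic count start at level 0.\<close>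

lemma frolov_infnorm_ge_1:
  fixes B :: "real^'d^'d"
  assumes "frolov_matrix B" "m \<in> int_lattice - {0}"
  shows "1 \<le> infnorm (B *v m)"
proof (rule ccontr)
  assume "\<not> 1 \<le> infnorm (B *v m)"
  then have "\<bar>(B *v m) $ j\<bar> < 1" for j
    using component_le_infnorm_cart[of "B *v m" j] by linarith
  then have "(\<Prod>j\<in>UNIV. \<bar>(B *v m) $ j\<bar>) < (\<Prod>j\<in>(UNIV :: 'd set). 1)"
    by (intro prod_mono_strict) (auto intro: less_imp_le)
  moreover have "1 \<le> \<bar>\<Prod>j\<in>UNIV. (B *v m) $ j\<bar>"
    using assms by (auto simp: frolov_matrix_def)
  ultimately show False
    by (simp add: abs_prod)
qed

lemma card_frolov_infnorm_le:
  fixes B :: "real^'d^'d"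
  assumes B: "frolov_matrix B" and A: "A \<subseteq> int_lattice" "\<And>m. m \<in> A \<Longrightarrow> infnorm (B *v m) \<le> r" and r: "0 \<le> r"
  shows "real (card A) \<le> (2 * r) ^ CARD('d) + 1"
proof -
  let ?box = "between_box (\<chi> j. - r) (\<chi> j. r) :: (real^'d) set"
  have fin: "finite (?box \<inter> (*v) B ` int_lattice)"
    and le: "real (card (?box \<inter> (*v) B ` int_lattice)) \<le> (\<Prod>j\<in>(UNIV :: 'd set). \<bar>- r - r\<bar>) + 1"
    using B[unfolded frolov_matrix_def, THEN conjunct2, THEN conjunct2,
        rule_format, of "\<chi> j. - r" "\<chi> j. r"] by simp_all
  have "(*v) B ` A \<subseteq> ?box \<inter> (*v) B ` int_lattice"
  proof safe
    fix m assume m: "m \<in> A"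
    have "\<bar>(B *v m) $ j\<bar> \<le> r" for j
      using component_le_infnorm_cart[of "B *v m" j] A(2)[OF m] by linarith
    then show "B *v m \<in> ?box"
      using r by (auto simp: between_box_def abs_le_iff minus_le_iff)
  qed (use A in auto)
  then have "card ((*v) B ` A) \<le> card (?box \<inter> (*v) B ` int_lattice)"
    by (rule card_mono[OF fin])
  then have "real (card A) \<le> real (card (?box \<inter> (*v) B ` int_lattice))"
    by (simp add: card_image[OF matrix_vector_inj_on_lattice[OF B]])
  also have "\<dots> \<le> (2 * r) ^ CARD('d) + 1"
    using le r by simp
  finally show ?thesis .
qed

text \<open>Dyadic level k holds at most 2 * 4^d * 2^(k d) points, each contributing at most 2^(-2 s
  k). The levels are dominated by a geometric series of ratio 1/2 and sum 2, whence the constant 2 *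
  4^d * 2.\<close>

lemma sum_infnorm_frolov_le:
  fixes B :: "real^'d^'d"
  assumes B: "frolov_matrix B" and s: "CARD('d) < 2 * s" and A: "finite A" "A \<subseteq> int_lattice - {0}"
  shows "(\<Sum>m\<in>A. 1 / infnorm (B *v m) ^ (2 * s)) \<le> 4 * 4 ^ CARD('d)"
proof -
  let ?d = "CARD('d)"
  \<comment> \<open>On \<open>A\<close> the logarithm is nonnegative, so \<open>nat\<close>
    truncates nothing.\<close>
  define lev where "lev m = nat \<lfloor>log 2 (infnorm (B *v m))\<rfloor>" for m
  have lev: "2 ^ lev m \<le> infnorm (B *v m) \<and> infnorm (B *v m) \<le> 2 ^ Suc (lev m)" if "m \<in> A" for m
  proof -
    let ?r = "infnorm (B *v m)"
    have r: "1 \<le> ?r"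
      using frolov_infnorm_ge_1[OF B] A(2) that by blast
    then have l0: "0 \<le> log 2 ?r"
      by simp
    have fl: "real (lev m) \<le> log 2 ?r" "log 2 ?r \<le> real (lev m) + 1"
      unfolding lev_def using l0 by linarith+
    have "2 powr real (lev m) \<le> ?r"
      using fl(1) r by (simp add: le_log_iff)
    moreover have "?r \<le> 2 powr real (Suc (lev m))"
      using fl(2) r by (simp add: log_le_iff add.commute)
    ultimately show ?thesis
      by (simp only: powr_realpow zero_less_numeral)
  qed
  have lev_card: "real (card {m\<in>A. lev m = k}) \<le> 2 * 4 ^ ?d * 2 ^ (k * ?d)" for k
  proof -
    have "real (card {m\<in>A. lev m = k}) \<le> (2 * 2 ^ Suc k) ^ ?d + 1"
      using lev A(2) by (intro card_frolov_infnorm_le[OF B]) auto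
    also have "(2 * 2 ^ Suc k :: real) ^ ?d = 4 ^ ?d * 2 ^ (k * ?d)"
    proof -
      have "(2 * 2 ^ Suc k :: real) = 4 * 2 ^ k"
        by simp
      then show ?thesis
        by (simp only: power_mult_distrib power_mult)
    qed
    \<comment> \<open>The additive 1 of the Frolov count is absorbed by doubling the main term,
      which is at least 1.\<close>
    also have "4 ^ ?d * 2 ^ (k * ?d) + 1 \<le> 4 ^ ?d * 2 ^ (k * ?d) + (4 ^ ?d * 2 ^ (k * ?d) :: real)"
    proof -
      have "1 * 1 \<le> (4 ^ ?d * 2 ^ (k * ?d) :: real)"
        by (intro mult_mono one_le_power) auto
      then show ?thesis by simp
    qed
    finally show ?thesis by simp
  qed
  obtain n where n: "lev ` A \<subseteq> {..<n}"
    using A(1) finite_nat_bounded[of "lev ` A"] by auto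
  have "(\<Sum>m\<in>A. 1 / infnorm (B *v m) ^ (2 * s)) \<le> (\<Sum>m\<in>A. 1 / (2 ^ lev m) ^ (2 * s))"
    using lev by (intro sum_mono divide_left_mono power_mono) (auto intro!: mult_pos_pos zero_less_power intro: less_le_trans[OF _ conjunct1[OF lev]])
  also have "\<dots> = (\<Sum>k<n. \<Sum>m\<in>{m\<in>A. lev m = k}. 1 / (2 ^ lev m) ^ (2 * s))"
    using A(1) n by (intro sum.group[symmetric]) auto
  also have "\<dots> = (\<Sum>k<n. real (card {m\<in>A. lev m = k}) / 2 ^ (k * (2 * s)))"
    by (intro sum.cong refl) (simp add: power_mult)
  also have "\<dots> \<le> (\<Sum>k<n. 2 * 4 ^ ?d * (1/2) ^ k)"
  proof (rule sum_mono)
    fix k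
    have "real (card {m\<in>A. lev m = k}) / 2 ^ (k * (2 * s)) \<le> 2 * 4 ^ ?d * 2 ^ (k * ?d) / 2 ^ (k * (2 * s))"
      by (intro divide_right_mono lev_card) auto
    \<comment> \<open>Both sides being integers, d < 2 s means d + 1 \<le> 2 s; the spare unit
      yields the ratio 1/2.\<close>
    also have "\<dots> \<le> 2 * 4 ^ ?d * 2 ^ (k * ?d) / 2 ^ (k * (?d + 1))"
      using s by (intro divide_left_mono power_increasing mult_le_mono) auto
    also have "\<dots> = 2 * 4 ^ ?d * (1/2) ^ k"
      by (simp add: power_add power_divide field_simps)
    finally show "real (card {m\<in>A. lev m = k}) / 2 ^ (k * (2 * s)) \<le> 2 * 4 ^ ?d * (1/2) ^ k" .
  qed
  also have "\<dots> = 2 * 4 ^ ?d * (\<Sum>k<n. (1/2) ^ k)"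
    by (simp add: sum_distrib_left)
  also have "\<dots> \<le> 2 * 4 ^ ?d * 2"
  proof (intro mult_left_mono)
    have "(\<Sum>k<n. (1/2 :: real) ^ k) = 2 * (1 - (1/2) ^ n)"
      by (subst sum_gp_strict) auto
    then show "(\<Sum>k<n. (1/2 :: real) ^ k) \<le> 2"
      by simp
  qed auto
  finally show ?thesis by simp
qed

subsection \<open>The error bound for one matrix\<close>

lemma diag_mult_vec: "((diag w ** B) *v m) $ i = w $ i * (B *v m) $ i"
proof -
  have "(diag w *v y) $ i = w $ i * y $ i" for y
    by (simp add: diag_def matrix_vector_mult_def if_distrib[of "\<lambda>z. z * _"] cong: if_cong)
  then show ?thesis
    by (simp flip: matrix_vector_mul_assoc)
qed

lemma diag_mult_entry: "(diag w ** B) $ i $ j = w $ i * B $ i $ j"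
  by (simp add: diag_def matrix_matrix_mult_def if_distrib[of "\<lambda>z. z * _"] cong: if_cong)

lemma det_diag_mult: "det (diag w ** B) = (\<Prod>i\<in>UNIV. w $ i) * det B"
proof -
  have "det (diag w) = (\<Prod>i\<in>UNIV. w $ i)"
    by (subst det_diagonal) (auto simp: diag_def)
  then show ?thesis
    by (simp add: det_mul)
qed

lemma infnorm_attained:
  fixes x :: "real^'d"
  obtains j where "\<bar>x $ j\<bar> = infnorm x"
proof -
  have "infnorm x = Sup (range (\<lambda>i. \<bar>x $ i\<bar>))"
    by (simp add: infnorm_cart full_SetCompr_eq)
  also have "\<dots> = Max (range (\<lambda>i. \<bar>x $ i\<bar>))"
    by (rule cSup_eq_Max) auto
  also have "\<dots> \<in> range (\<lambda>i. \<bar>x $ i\<bar>)"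
    by (rule Max_in) auto
  finally show thesis
    using that by auto
qed

lemma sum_weak_deriv_axis_le_sobolev_norm:
  fixes f :: "real^'d \<Rightarrow> real"
  assumes "s \<ge> 1"
  shows "(\<Sum>j\<in>UNIV. LINT y:cbox 0 1|lborel. (weak_deriv (\<chi> i. if i = j then s else 0) f y)\<^sup>2)
    \<le> (sobolev_norm s f)\<^sup>2"
proof -
  let ?e = "\<lambda>j. (\<chi> i. if i = j then s else 0) :: nat^'d"
  have nonneg: "0 \<le> (LINT y:cbox 0 1|lborel. (g y)\<^sup>2)" for g :: "real^'d \<Rightarrow> real"
    unfolding set_lebesgue_integral_def by (intro Bochner_Integration.integral_nonneg) simp
  \<comment> \<open>For s = 0 these multi-indices would all be 0, and the sum would repeat one term
    d times.\<close>
  have inj: "inj ?e"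
  proof (rule injI)
    fix j k :: 'd assume "?e j = ?e k"
    then have "?e j $ j = ?e k $ j"
      by simp
    then show "j = k"
      using assms by (auto split: if_splits)
  qed
  have "(\<Sum>j\<in>UNIV. LINT y:cbox 0 1|lborel. (weak_deriv (?e j) f y)\<^sup>2)
      = (\<Sum>\<alpha>\<in>range ?e. LINT y:cbox 0 1|lborel. (weak_deriv \<alpha> f y)\<^sup>2)"
    using inj by (simp add: sum.reindex)
  also have "\<dots> \<le> (\<Sum>\<alpha> | multi_order \<alpha> \<le> s. LINT y:cbox 0 1|lborel. (weak_deriv \<alpha> f y)\<^sup>2)"
    by (intro sum_mono2 finite_multi_order_le nonneg) (auto simp: multi_order_axis)
  also have "\<dots> = (sobolev_norm s f)\<^sup>2"
    unfolding sobolev_norm_def L2_norm_on_def by (simp add: nonneg sum_nonneg)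
  finally show ?thesis .
qed

text \<open>In the coordinates \<open>x = S\<^sup>T y\<close> the rule is a sum over the integer lattice, whose frequencies
  are the lattice points \<open>S m\<close>.\<close>

lemma quadrature_error_le:
  fixes S :: "real^'d^'d" and f :: "real^'d \<Rightarrow> real"
  assumes S: "invertible S" and cont: "continuous_on UNIV f"
    and supp: "\<And>x. f x \<noteq> 0 \<Longrightarrow> x \<in> cbox a b"
    and bound: "\<And>A. finite A \<Longrightarrow> A \<subseteq> int_lattice - {0} \<Longrightarrow>
      (\<Sum>m\<in>A. cmod (LINT y|lborel. complex_of_real (f y) * char (S *v m) y)) \<le> K"
  shows "\<bar>quadrature S v f - (LINT y|lborel. f y)\<bar> \<le> K"
proof -
  define R where "R = transpose (matrix_inv S)"
  define F where "F x = f (R *v (x + v))" for x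
  have det: "det S \<noteq> 0"
    using S by (simp add: invertible_det_nz)
  have inv: "transpose S ** R = mat 1" "R ** transpose S = mat 1"
    using someI_ex[OF S[unfolded invertible_def], folded matrix_inv_def]
    by (simp_all add: R_def matrix_transpose_mul[symmetric] transpose_mat)
  then have R: "invertible R"
    by (auto simp: invertible_def)
  have SR: "transpose S *v (R *v x) = x" for x
    by (simp add: matrix_vector_mul_assoc inv)
  have detR: "\<bar>det R\<bar> = 1 / \<bar>det S\<bar>"
  proof -
    have "det S * det R = 1"
      using arg_cong[OF inv(1), of det] by (simp add: det_mul det_transpose)
    then have "\<bar>det S\<bar> * \<bar>det R\<bar> = 1"
      by (simp flip: abs_mult)
    then show ?thesis
      using det by (simp add: field_simps)
  qed
  have contR: "continuous_on UNIV ((*v) R)"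
    by (intro linear_continuous_on matrix_vector_mul_bounded_linear)
  have contF: "continuous_on UNIV F"
    unfolding F_def
    by (intro continuous_on_compose2[OF cont] continuous_on_compose2[OF contR] continuous_intros) auto
  have integral_subst: "(LINT x|lborel. h (R *v x)) = \<bar>det S\<bar> *\<^sub>R (LINT y|lborel. h y)"
    if "h \<in> borel_measurable borel" for h :: "real^'d \<Rightarrow> 'b::{banach, second_countable_topology}"
    unfolding lborel_integral_linear[OF R that, symmetric] detR using det by simp
  \<comment> \<open>This provides some \<open>L\<close> for the support of \<open>F\<close>. It may
    depend on v and S, since \<open>L\<close> is absent from the conclusion of
    \<open>lattice_sum_minus_integral_le\<close>.\<close>
  have "compact ((\<lambda>y. transpose S *v y - v) ` cbox a b)"
    by (intro compact_continuous_image continuous_intros linear_continuous_on matrix_vector_mul_bounded_linear) auto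
  then have "bounded ((\<lambda>y. transpose S *v y - v) ` cbox a b)"
    by (rule compact_imp_bounded)
  then obtain M where M: "\<And>x. x \<in> (\<lambda>y. transpose S *v y - v) ` cbox a b \<Longrightarrow> norm x \<le> M"
    unfolding bounded_iff by blast
  obtain L :: nat where L: "M \<le> real L"
    using real_arch_simple by blast
  have suppF: "\<bar>x $ j\<bar> \<le> real L" if "F x \<noteq> 0" for x j
  proof -
    have "R *v (x + v) \<in> cbox a b"
      using that supp by (simp add: F_def)
    then have "x \<in> (\<lambda>y. transpose S *v y - v) ` cbox a b"
      by (intro image_eqI[of _ _ "R *v (x + v)"]) (simp_all only: SR add_diff_cancel_right')
    from M[OF this] show ?thesis
      using L component_le_norm_cart[of x j] by linarith
  qed
  have meas: "f \<in> borel_measurable borel"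
    by (rule borel_measurable_continuous_onI[OF cont])
  have meas_fc: "(\<lambda>y. complex_of_real (f y) * char (S *v m) y) \<in> borel_measurable borel" for m
    using meas by measurable
  have int_F: "(LINT x|lborel. F x) = \<bar>det S\<bar> * (LINT y|lborel. f y)"
  proof -
    have "(LINT x|lborel. F x) = (LINT x|lborel. f (R *v x))"
      unfolding F_def using meas by (intro lborel_integral_translate measurable_compose[OF borel_measurable_matrix_vector_mult])
    then show ?thesis
      using integral_subst[OF meas] by simp
  qed
  have coeff: "cmod (LINT x|lborel. complex_of_real (F x) * char m x)
      = \<bar>det S\<bar> * cmod (LINT y|lborel. complex_of_real (f y) * char (S *v m) y)" for m
  proof -
    \<comment> \<open>The shift v survives only as the phase \<open>char m (- v)\<close>, which the
      norm removes.\<close>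
    have "complex_of_real (F x) * char m x
        = char m (- v) * (complex_of_real (f (R *v (x + v))) * char (S *v m) (R *v (x + v)))" for x
    proof -
      have "char m x = char m (- v) * char m (x + v)"
        using char_add_right[of m "- v" "x + v"] by simp
      then show ?thesis
        by (simp add: F_def char_matrix SR del: transpose_matrix_vector)
    qed
    then have "(LINT x|lborel. complex_of_real (F x) * char m x)
        = char m (- v) * (LINT x|lborel. complex_of_real (f (R *v (x + v))) * char (S *v m) (R *v (x + v)))"
      by simp
    also have "(LINT x|lborel. complex_of_real (f (R *v (x + v))) * char (S *v m) (R *v (x + v)))
        = (LINT x|lborel. complex_of_real (f (R *v x)) * char (S *v m) (R *v x))"
      using measurable_compose[OF borel_measurable_matrix_vector_mult meas_fc]
      by (rule lborel_integral_translate)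
    also have "\<dots> = \<bar>det S\<bar> *\<^sub>R (LINT y|lborel. complex_of_real (f y) * char (S *v m) y)"
      by (rule integral_subst[OF meas_fc])
    finally show ?thesis
      by (simp add: norm_mult)
  qed
  have "\<bar>(\<Sum>\<^sub>\<infinity>m\<in>int_lattice. F m) - (LINT x|lborel. F x)\<bar> \<le> \<bar>det S\<bar> * K"
  proof (rule lattice_sum_minus_integral_le[OF contF suppF])
    fix A :: "(real^'d) set" assume "finite A" "A \<subseteq> int_lattice - {0}"
    from bound[OF this] show "(\<Sum>m\<in>A. cmod (LINT x|lborel. complex_of_real (F x) * char m x)) \<le> \<bar>det S\<bar> * K"
      by (simp add: coeff mult_left_mono flip: sum_distrib_left)
  qed
  moreover have "quadrature S v f = (\<Sum>\<^sub>\<infinity>m\<in>int_lattice. F m) / \<bar>det S\<bar>"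
    by (simp add: quadrature_def F_def R_def)
  then have "quadrature S v f - (LINT y|lborel. f y)
      = ((\<Sum>\<^sub>\<infinity>m\<in>int_lattice. F m) - (LINT x|lborel. F x)) / \<bar>det S\<bar>"
    using det by (simp add: int_F field_simps)
  ultimately show ?thesis
    using det by (simp add: abs_divide divide_le_eq mult.commute)
qed

text \<open>All w within a factor 2 of r share the constants: the transpose of S sends the cube into
  a box of size 2 r \<beta>, while \<bar>det S\<bar> is at least r^d \<bar>det B\<bar>. The powers
  r^d cancel in the Bessel constant, and only the r^(-s) of the Cauchy-Schwarz weights is
  left.\<close>

lemma quadrature_diag_frolov_error_le:
  fixes B :: "real^'d^'d" and f :: "real^'d \<Rightarrow> real"
  assumes B: "frolov_matrix B" and s: "s \<ge> 1" "CARD('d) < 2 * s" and f: "f \<in> sobolev_cube s"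
    and r: "1 \<le> r" and w: "\<And>i. r \<le> w $ i" "\<And>i. w $ i \<le> 2 * r"
  defines "\<beta> \<equiv> \<Sum>i\<in>UNIV. \<Sum>j\<in>UNIV. \<bar>B $ i $ j\<bar>"
  shows "\<bar>quadrature (diag w ** B) v f - (LINT y|lborel. f y)\<bar>
    \<le> sqrt (4 * 4 ^ CARD('d)) * sqrt ((4 * \<beta> + 5) ^ CARD('d) / \<bar>det B\<bar>) / r ^ s * sobolev_norm s f"
proof -
  let ?d = "CARD('d)"
  let ?C = "cbox 0 1 :: (real^'d) set"
  define S where "S = diag w ** B"
  define C\<^sub>1 where "C\<^sub>1 = (4 * \<beta> + 5) ^ ?d / \<bar>det B\<bar>"
  define fhat where "fhat m = (LINT y|lborel. complex_of_real (f y) * char (S *v m) y)" for m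
  define g where "g j = weak_deriv (\<chi> i. if i = j then s else 0) f" for j
  define ghat where "ghat j m = (LINT y:?C|lborel. complex_of_real (g j y) * char (S *v m) y)" for j m
  have detB: "det B \<noteq> 0"
    using B by (simp add: frolov_matrix_def invertible_det_nz)
  have \<beta>: "0 \<le> \<beta>"
    unfolding \<beta>_def by (intro sum_nonneg) auto
  have detS_ge: "r ^ ?d * \<bar>det B\<bar> \<le> \<bar>det S\<bar>"
  proof -
    have "(\<Prod>i\<in>(UNIV :: 'd set). r) \<le> (\<Prod>i\<in>UNIV. \<bar>w $ i\<bar>)"
    proof (rule prod_mono)
      fix i show "0 \<le> r \<and> r \<le> \<bar>w $ i\<bar>"
        using w(1)[of i] r by auto
    qed
    then show ?thesis
      by (simp add: S_def det_diag_mult abs_mult abs_prod mult_right_mono)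
  qed
  moreover have "0 < r ^ ?d * \<bar>det B\<bar>"
    using r detB by simp
  ultimately have detS: "det S \<noteq> 0"
    by auto
  then have invS: "invertible S"
    by (simp add: invertible_det_nz)
  have cont: "continuous_on UNIV f" and supp: "closure {x. f x \<noteq> 0} \<subseteq> ?C"
    and sob: "f \<in> sobolev s"
    using f by (auto simp: sobolev_cube_def)
  have weak: "is_weak_deriv (\<chi> i. if i = j then s else 0) f (g j)"
    and sq: "square_integrable (g j)" for j
  proof -
    have "multi_order ((\<chi> i. if i = j then s else 0) :: nat^'d) \<le> s"
      by (simp add: multi_order_axis)
    then have "(\<exists>h. is_weak_deriv (\<chi> i. if i = j then s else 0) f h)
        \<and> square_integrable (weak_deriv (\<chi> i. if i = j then s else 0) f)"
      using sob unfolding sobolev_def by blast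
    then show "is_weak_deriv (\<chi> i. if i = j then s else 0) f (g j)" "square_integrable (g j)"
      unfolding g_def weak_deriv_def by (metis someI_ex)+
  qed
  define L where "L = nat \<lceil>2 * r * \<beta>\<rceil>"
  have "0 \<le> 2 * r * \<beta>"
    using r \<beta> by simp
  then have L: "2 * r * \<beta> \<le> real L" "real L \<le> 2 * r * \<beta> + 1"
    unfolding L_def by linarith+
  have C_le: "\<bar>(transpose S *v y) $ j\<bar> \<le> real L" if "y \<in> ?C" for y j
  proof -
    have "\<bar>(transpose S *v y) $ j\<bar> \<le> (\<Sum>i\<in>UNIV. \<bar>w $ i * B $ i $ j * y $ i\<bar>)"
      unfolding matrix_vector_mult_def transpose_def S_def by (simp add: diag_mult_entry sum_abs)
    also have "\<dots> \<le> (\<Sum>i\<in>UNIV. 2 * r * (\<Sum>k\<in>UNIV. \<bar>B $ i $ k\<bar>))"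
    proof (rule sum_mono)
      fix i
      have y: "0 \<le> y $ i" "y $ i \<le> 1"
        using that by (auto simp: mem_box_cart)
      have "\<bar>B $ i $ j\<bar> \<le> (\<Sum>k\<in>UNIV. \<bar>B $ i $ k\<bar>)"
        by (rule member_le_sum) auto
      then have "\<bar>w $ i\<bar> * \<bar>B $ i $ j\<bar> * \<bar>y $ i\<bar> \<le> (2 * r) * (\<Sum>k\<in>UNIV. \<bar>B $ i $ k\<bar>) * 1"
        using w(1)[of i] w(2)[of i] r y by (intro mult_mono) (auto intro: sum_nonneg)
      then show "\<bar>w $ i * B $ i $ j * y $ i\<bar> \<le> 2 * r * (\<Sum>k\<in>UNIV. \<bar>B $ i $ k\<bar>)"
        by (simp add: abs_mult)
    qed
    also have "\<dots> = 2 * r * \<beta>"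
      by (simp add: \<beta>_def sum_distrib_left)
    finally show ?thesis
      using L(1) by simp
  qed
  have bessel: "(\<Sum>m\<in>A. (cmod (ghat j m))\<^sup>2) \<le> C\<^sub>1 * (LINT y:?C|lborel. (g j y)\<^sup>2)"
    if A: "finite A" "A \<subseteq> int_lattice" for A j
  proof -
    have sqC: "set_integrable lborel ?C (\<lambda>y. (g j y)\<^sup>2)"
      unfolding set_integrable_def
      using sq[of j] by (intro integrable_mult_indicator) (auto simp: square_integrable_def)
    have "(\<Sum>m\<in>A. (cmod (ghat j m))\<^sup>2)
        \<le> real (2 * L + 3) ^ ?d / \<bar>det S\<bar> * (LINT y:?C|lborel. (g j y)\<^sup>2)"
      unfolding ghat_def
      using sq[of j] by (intro bessel_matrix_lattice[OF invS _ _ _ sqC C_le A])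
        (use emeasure_bounded_finite[OF bounded_cbox] in \<open>auto simp: square_integrable_def\<close>)
    also have "\<dots> \<le> C\<^sub>1 * (LINT y:?C|lborel. (g j y)\<^sup>2)"
    proof (rule mult_right_mono)
      \<comment> \<open>Rounding up costs one in L, so 2 L + 3 \<le> 4 r \<beta> + 5; then r \<ge> 1
        allows r to be factored out. This is the origin of 4 \<beta> + 5.\<close>
      have "real (2 * L + 3) \<le> r * (4 * \<beta> + 5)"
      proof -
        have "real (2 * L + 3) \<le> 4 * (r * \<beta>) + 5"
          using L(2) by simp
        also have "\<dots> \<le> r * (4 * \<beta> + 5)"
          using r by (simp add: algebra_simps)
        finally show ?thesis .
      qed
      then have "real (2 * L + 3) ^ ?d \<le> (r * (4 * \<beta> + 5)) ^ ?d"
        by (rule power_mono) simp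
      then have "real (2 * L + 3) ^ ?d / \<bar>det S\<bar> \<le> (r * (4 * \<beta> + 5)) ^ ?d / (r ^ ?d * \<bar>det B\<bar>)"
        using r \<beta> detB detS_ge by (intro frac_le) auto
      also have "\<dots> = C\<^sub>1"
        using r by (simp add: C\<^sub>1_def power_mult_distrib)
      finally show "real (2 * L + 3) ^ ?d / \<bar>det S\<bar> \<le> C\<^sub>1" .
      show "0 \<le> (LINT y:?C|lborel. (g j y)\<^sup>2)"
        unfolding set_lebesgue_integral_def by (intro Bochner_Integration.integral_nonneg) simp
    qed
    finally show ?thesis .
  qed
  have transfer: "\<bar>(S *v m) $ j\<bar> ^ s * cmod (fhat m) \<le> cmod (ghat j m)" for m j
  proof -
    define \<xi> where "\<xi> = (2 * pi) *\<^sub>R (S *v m)"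
    have char: "char (S *v m) y = cis (\<xi> \<bullet> y)" for y
      by (simp add: char_def \<xi>_def)
    \<comment> \<open>The true frequency is 2 pi times the lattice point; since 2 pi \<ge> 1 the
      factor is simply dropped.\<close>
    have "1 * \<bar>(S *v m) $ j\<bar> \<le> \<bar>\<xi> $ j\<bar>"
      using pi_gt3 unfolding \<xi>_def by (simp add: abs_mult) (intro mult_right_mono[of 1 "2 * pi", simplified], auto)
    then have "\<bar>(S *v m) $ j\<bar> ^ s * cmod (fhat m) \<le> \<bar>\<xi> $ j\<bar> ^ s * cmod (fhat m)"
      by (intro mult_right_mono power_mono) auto
    also have "\<dots> = cmod (ghat j m)"
      unfolding fhat_def ghat_def char by (rule norm_fourier_weak_deriv_axis[OF cont supp weak])
    finally show ?thesis .
  qed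
  \<comment> \<open>The coordinate that attains the maximum norm varies with m, so the bound sums
    over all coordinates.\<close>
  have ptw: "((r * infnorm (B *v m)) ^ s * cmod (fhat m))\<^sup>2 \<le> (\<Sum>j\<in>UNIV. (cmod (ghat j m))\<^sup>2)" for m
  proof -
    obtain j where j: "\<bar>(B *v m) $ j\<bar> = infnorm (B *v m)"
      by (rule infnorm_attained)
    have "r * infnorm (B *v m) \<le> \<bar>w $ j\<bar> * \<bar>(B *v m) $ j\<bar>"
      unfolding j using w(1)[of j] by (intro mult_right_mono infnorm_pos_le) auto
    also have "\<dots> = \<bar>(S *v m) $ j\<bar>"
      by (simp add: S_def diag_mult_vec abs_mult)
    finally have "(r * infnorm (B *v m)) ^ s * cmod (fhat m) \<le> \<bar>(S *v m) $ j\<bar> ^ s * cmod (fhat m)"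
      using r by (intro mult_right_mono power_mono) (auto simp: infnorm_pos_le)
    also have "\<dots> \<le> cmod (ghat j m)"
      by (rule transfer)
    finally have "((r * infnorm (B *v m)) ^ s * cmod (fhat m))\<^sup>2 \<le> (cmod (ghat j m))\<^sup>2"
      using r by (intro power_mono) (auto simp: infnorm_pos_le)
    also have "\<dots> \<le> (\<Sum>j\<in>UNIV. (cmod (ghat j m))\<^sup>2)"
      by (rule member_le_sum) auto
    finally show ?thesis .
  qed
  have "\<bar>quadrature S v f - (LINT y|lborel. f y)\<bar>
      \<le> sqrt (4 * 4 ^ ?d) / r ^ s * (sqrt C\<^sub>1 * sobolev_norm s f)"
  proof (rule quadrature_error_le[OF invS cont])
    show "x \<in> cbox 0 1" if "f x \<noteq> 0" for x
      using support_in_open_cube[OF cont supp that] box_subset_cbox by blast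
    fix A :: "(real^'d) set" assume A: "finite A" "A \<subseteq> int_lattice - {0}"
    define \<rho> where "\<rho> m = (r * infnorm (B *v m)) ^ s" for m
    have \<rho>: "0 < \<rho> m" if "m \<in> A" for m
    proof -
      have "1 \<le> infnorm (B *v m)"
        using that A(2) by (intro frolov_infnorm_ge_1[OF B]) blast
      then show ?thesis
        unfolding \<rho>_def using r by (intro zero_less_power mult_pos_pos) auto
    qed
    have "(\<Sum>m\<in>A. cmod (fhat m)) = (\<Sum>m\<in>A. \<bar>1 / \<rho> m\<bar> * \<bar>\<rho> m * cmod (fhat m)\<bar>)"
      using \<rho> by (intro sum.cong) (auto simp: abs_mult less_imp_neq[symmetric])
    also have "\<dots> \<le> L2_set (\<lambda>m. 1 / \<rho> m) A * L2_set (\<lambda>m. \<rho> m * cmod (fhat m)) A"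
      by (rule L2_set_mult_ineq)
    also have "\<dots> \<le> sqrt (4 * 4 ^ ?d) / r ^ s * (sqrt C\<^sub>1 * sobolev_norm s f)"
    proof (rule mult_mono)
      have "(\<Sum>m\<in>A. (1 / \<rho> m)\<^sup>2) = (\<Sum>m\<in>A. 1 / infnorm (B *v m) ^ (2 * s)) / (r ^ s)\<^sup>2"
        by (simp add: \<rho>_def sum_divide_distrib power_mult_distrib power_divide mult.commute[of 2 s] power_mult)
          (simp add: mult.commute)
      also have "\<dots> \<le> 4 * 4 ^ ?d / (r ^ s)\<^sup>2"
        by (intro divide_right_mono sum_infnorm_frolov_le[OF B s(2) A]) simp
      finally have "L2_set (\<lambda>m. 1 / \<rho> m) A \<le> sqrt (4 * 4 ^ ?d / (r ^ s)\<^sup>2)"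
        unfolding L2_set_def by (rule real_sqrt_le_mono)
      then show "L2_set (\<lambda>m. 1 / \<rho> m) A \<le> sqrt (4 * 4 ^ ?d) / r ^ s"
        using r by (simp add: real_sqrt_divide)
      have "(\<Sum>m\<in>A. (\<rho> m * cmod (fhat m))\<^sup>2) \<le> (\<Sum>m\<in>A. \<Sum>j\<in>UNIV. (cmod (ghat j m))\<^sup>2)"
        unfolding \<rho>_def by (intro sum_mono ptw)
      also have "\<dots> = (\<Sum>j\<in>UNIV. \<Sum>m\<in>A. (cmod (ghat j m))\<^sup>2)"
        by (rule sum.swap)
      also have "\<dots> \<le> (\<Sum>j\<in>UNIV. C\<^sub>1 * (LINT y:?C|lborel. (g j y)\<^sup>2))"
        using A by (intro sum_mono bessel) auto
      also have "\<dots> = C\<^sub>1 * (\<Sum>j\<in>UNIV. LINT y:?C|lborel. (g j y)\<^sup>2)"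
        by (simp add: sum_distrib_left)
      also have "\<dots> \<le> C\<^sub>1 * (sobolev_norm s f)\<^sup>2"
        unfolding g_def using \<beta>
        by (intro mult_left_mono sum_weak_deriv_axis_le_sobolev_norm s) (auto simp: C\<^sub>1_def)
      finally have "L2_set (\<lambda>m. \<rho> m * cmod (fhat m)) A \<le> sqrt (C\<^sub>1 * (sobolev_norm s f)\<^sup>2)"
        unfolding L2_set_def by (rule real_sqrt_le_mono)
      moreover have "0 \<le> sobolev_norm s f"
        by (simp add: sobolev_norm_def sum_nonneg)
      ultimately show "L2_set (\<lambda>m. \<rho> m * cmod (fhat m)) A \<le> sqrt C\<^sub>1 * sobolev_norm s f"
        by (simp add: real_sqrt_mult)
    qed (use r in \<open>auto simp: L2_set_nonneg\<close>)
    finally show "(\<Sum>m\<in>A. cmod (LINT y|lborel. complex_of_real (f y) * char (S *v m) y))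
        \<le> sqrt (4 * 4 ^ ?d) / r ^ s * (sqrt C\<^sub>1 * sobolev_norm s f)"
      by (simp add: fhat_def)
  qed
  then show ?thesis
    by (simp add: S_def C\<^sub>1_def)
qed

theorem theorem4:
  fixes s :: nat and B :: "real^'d^'d"
  assumes "s \<ge> 1" and "real s > real CARD('d) / 2" and "frolov_matrix B"
  shows "\<exists>c::real. c > 0 \<and>
    (\<forall>(v :: real^'d) (n :: nat) (f :: real^'d \<Rightarrow> real). n \<ge> 1 \<longrightarrow> f \<in> sobolev_cube s \<longrightarrow>
      (SUP u \<in> {u :: real^'d. \<forall>j. u $ j \<in> {1..2 powr (1 / real CARD('d))}}.
         ereal \<bar>quadrature (real n powr (1 / real CARD('d)) *\<^sub>R (diag u ** B)) v f
                - (LINT x|lborel. f x)\<bar>)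
      \<le> ereal (c * real n powr (- (real s / real CARD('d))) * sobolev_norm s f))"
proof -
  let ?d = "CARD('d)"
  define \<beta> where "\<beta> = (\<Sum>i\<in>UNIV. \<Sum>j\<in>UNIV. \<bar>B $ i $ j\<bar>)"
  define c where "c = sqrt (4 * 4 ^ ?d) * sqrt ((4 * \<beta> + 5) ^ ?d / \<bar>det B\<bar>)"
  have "det B \<noteq> 0"
    using assms(3) by (simp add: frolov_matrix_def invertible_det_nz)
  moreover have "0 \<le> \<beta>"
    unfolding \<beta>_def by (intro sum_nonneg) auto
  ultimately have "0 < c"
    unfolding c_def by (intro mult_pos_pos real_sqrt_gt_zero divide_pos_pos zero_less_power) auto
  moreover have "\<bar>quadrature (real n powr (1 / real ?d) *\<^sub>R (diag u ** B)) v f - (LINT x|lborel. f x)\<bar>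
      \<le> c * real n powr (- (real s / real ?d)) * sobolev_norm s f"
    if n: "n \<ge> 1" and f: "f \<in> sobolev_cube s" and u: "\<forall>j. u $ j \<in> {1..2 powr (1 / real ?d)}" for v n f u
  proof -
    define r where "r = real n powr (1 / real ?d)"
    have r: "1 \<le> r"
      using n by (simp add: r_def ge_one_powr_ge_zero)
    \<comment> \<open>As d \<ge> 1, the entries of u lie in [1, 2], and those of r u in
      [r, 2 r].\<close>
    have "(2 :: real) powr (1 / real ?d) \<le> 2 powr 1"
      by (intro powr_mono) (auto simp: Suc_le_eq)
    then have u2: "1 \<le> u $ i" "u $ i \<le> 2" for i
      using u[rule_format, of i] by auto
    have S_eq: "r *\<^sub>R (diag u ** B) = diag (r *\<^sub>R u) ** B"
      by (simp add: vec_eq_iff diag_mult_entry)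
    have "\<bar>quadrature (diag (r *\<^sub>R u) ** B) v f - (LINT x|lborel. f x)\<bar> \<le> c / r ^ s * sobolev_norm s f"
      unfolding c_def \<beta>_def
    proof (rule quadrature_diag_frolov_error_le[OF assms(3,1) _ f r])
      show "?d < 2 * s"
        using assms(2) by linarith
      show "r \<le> (r *\<^sub>R u) $ i" "(r *\<^sub>R u) $ i \<le> 2 * r" for i
        using r u2[of i] by auto
    qed
    moreover have "r ^ s = real n powr (real s / real ?d)"
      using n by (simp add: r_def powr_powr flip: powr_realpow)
    then have "c / r ^ s = c * real n powr (- (real s / real ?d))"
      by (simp add: powr_minus divide_inverse)
    ultimately show ?thesis
      by (simp only: S_eq r_def[symmetric])
  qed
  ultimately show ?thesis
    by (intro exI[of _ c]) (auto intro!: SUP_least)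
qed

end
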